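(* Let $m,n\ge 1$ be integers, $\alpha\in\mathbb{R}$, $B\in M_{m,n}$, and for $t\in\mathbb{R}$ let $\Phi^{+}_{t,B}:M_n\to M_m$ be $\Phi^{+}_{t,B}(Y)=t\,\mathrm{tr}(Y)I_m+BYB^*$. Let $A,X,C\in M_n$ be such that $\begin{bmatrix} A & X \\ X^* & C \end{bmatrix}$ is positive semidefinite. If $|\alpha|\ge\frac12\sigma_1(B)^2$, then for every $j\in\{1,\ldots,m\}$, \[2\sigma_j(\Phi^{+}_{\alpha,B}(X))\le 2\big(\sigma_j(BXB^* )+|\alpha|\,|\mathrm{tr}X|\big)\le\sigma_j(\Phi^{+}_{|\alpha|,B}(A+C)).\]
   Context: $M_{m,n}$ is the set of $m\times n$ complex matrices, $M_n=M_{n,n}$. Singular values are listed in decreasing order $\sigma_1\ge\sigma_2\ge\cdots$. *)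

theory Defs
  imports
    "HOL-Computational_Algebra.Fundamental_Theorem_Algebra"
    "Jordan_Normal_Form.Matrix"
    "Jordan_Normal_Form.Char_Poly"
    "Jordan_Normal_Form.Schur_Decomposition"
begin

definition mat_trace :: "'a :: comm_monoid_add mat \<Rightarrow> 'a" where
  "mat_trace A = (\<Sum>i<dim_row A. A $$ (i, i))"

definition psd :: "complex mat \<Rightarrow> bool" where
  "psd M \<longleftrightarrow> square_mat M \<and> mat_adjoint M = M \<and>
     (\<forall>v \<in> carrier_vec (dim_row M). 0 \<le> Re ((M *\<^sub>v v) \<bullet>c v))"

text \<open>The singular values of \<open>A\<close> are the square roots of the eigenvalues of \<open>A\<^sup>* A\<close>, repeated
  according to algebraic multiplicity, in decreasing order. The eigenvalues of \<open>A\<^sup>* A\<close> are real and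
  nonnegative, so \<^const>\<open>Re\<close> only changes the type. The list has as many entries as \<open>A\<close> has
  columns; if \<open>A\<close> has fewer rows than columns, the entries beyond the number of rows are the
  customary trailing zeros.\<close>

definition singular_values :: "complex mat \<Rightarrow> real list" where
  "singular_values A =
     rev (sorted_list_of_multiset
       (image_mset (\<lambda>z. sqrt (Re z)) (proots (char_poly (mat_adjoint A * A)))))"

text \<open>Singular values are numbered from 1, whereas lists are indexed from 0.\<close>

definition sing_val :: "nat \<Rightarrow> complex mat \<Rightarrow> real" where
  "sing_val j A = singular_values A ! (j - 1)"

lemma length_singular_values: "length (singular_values A) = dim_col A"
proof -
  have "mat_adjoint A * A \<in> carrier_mat (dim_col A) (dim_col A)"
    by (auto simp: mat_adjoint_def)
  then have "size (proots (char_poly (mat_adjoint A * A))) = dim_col A"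
    using degree_monic_char_poly size_proots_complex by metis
  then show ?thesis
    by (metis length_rev mset_sorted_list_of_multiset singular_values_def size_image_mset size_mset)
qed

definition Phi_plus :: "real \<Rightarrow> complex mat \<Rightarrow> complex mat \<Rightarrow> complex mat" where
  "Phi_plus t B Y =
     (complex_of_real t * mat_trace Y) \<cdot>\<^sub>m 1\<^sub>m (dim_row B) + B * Y * mat_adjoint B"

end

theory Submission
  imports Defs
begin

text \<open>Put \<open>w\<close> for a phase with \<open>w tr X = |tr X|\<close>, \<open>T\<close> for the block matrix, \<open>S = A + C - w X - w\<^sup>* X\<^sup>*\<close>,
  \<open>\<mu> = 2 \<sigma>\<^sub>j(B X B\<^sup>*)\<close> and \<open>q = |\<alpha>| tr S\<close>. As \<open>S\<close> is positive semidefinite and \<open>\<sigma>\<^sub>1(B)\<^sup>2 \<le> 2 |\<alpha>|\<close>,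
  the form of \<open>B S B\<^sup>*\<close> is at most \<open>2 q\<close> times the squared norm. Let \<open>v\<close> range over the span of the first \<open>j\<close>
  right singular vectors of \<open>B X B\<^sup>*\<close>, let \<open>u\<close> be the image of \<open>v\<close> under the partial isometry onto the left
  ones, and put \<open>(z\<^sub>1, z\<^sub>2) = T (B\<^sup>* u, B\<^sup>* v)\<close> and \<open>y = B (z\<^sub>1 + w\<^sup>* z\<^sub>2)\<close>. The Cauchy-Schwarz inequality for
  the form of \<open>T\<close>, applied to \<open>(B\<^sup>* u, B\<^sup>* v)\<close> and \<open>(B\<^sup>* y, \<plusminus> w B\<^sup>* y)\<close>, shows that the form of
  \<open>B (A + C) B\<^sup>*\<close> at \<open>y\<close> is at least \<open>(\<mu> - q) |y|\<^sup>2\<close>. Such \<open>y\<close> fill a space of dimension \<open>j\<close> if \<open>q < \<mu>\<close>, so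
  the \<open>j\<close>-th singular value of the right-hand matrix is at least
  \<open>\<mu> - q + |\<alpha>| tr (A + C) = \<mu> + 2 |\<alpha>| |tr X|\<close>.\<close>

subsection \<open>Adjoints and the real inner product\<close>

text \<open>The real inner product of C^n seen as R^(2n). The estimates below compare real numbers,
  so Cauchy-Schwarz and the adjoint identity are needed for this form only; phases are carried by
  explicit scalars.\<close>

definition re_inner :: "complex vec \<Rightarrow> complex vec \<Rightarrow> real" where
  "re_inner v w = Re (v \<bullet>c w)"

lemma mat_adjoint_index [simp]:
  "i < dim_col A \<Longrightarrow> j < dim_row A \<Longrightarrow> mat_adjoint A $$ (i, j) = conjugate (A $$ (j, i))"
  by (simp add: mat_adjoint_def mat_of_rows_def)

lemma mat_adjoint_dim [simp]:
  "dim_row (mat_adjoint A) = dim_col A" "dim_col (mat_adjoint A) = dim_row A"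
  by (simp_all add: mat_adjoint_def)

lemma mat_adjoint_carrier [simp, intro]:
  "A \<in> carrier_mat m n \<Longrightarrow> mat_adjoint A \<in> carrier_mat n m"
  by auto

lemma mat_adjoint_mult_vec_carrier [simp, intro]:
  "A \<in> carrier_mat m n \<Longrightarrow> mat_adjoint A *\<^sub>v v \<in> carrier_vec n"
  by (auto intro!: carrier_vecI)

lemma mat_adjoint_mat_adjoint [simp]: "mat_adjoint (mat_adjoint A) = A"
  by (rule eq_matI) auto

lemma mat_adjoint_add:
  "A \<in> carrier_mat m n \<Longrightarrow> B \<in> carrier_mat m n \<Longrightarrow>
    mat_adjoint (A + B) = mat_adjoint A + mat_adjoint B"
  by (rule eq_matI) (auto simp: conjugate_dist_add)

lemma mat_adjoint_smult: "mat_adjoint (c \<cdot>\<^sub>m A) = conjugate c \<cdot>\<^sub>m mat_adjoint A"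
  by (rule eq_matI) (auto simp: conjugate_dist_mul)

lemma mat_adjoint_one [simp]: "mat_adjoint (1\<^sub>m n :: complex mat) = 1\<^sub>m n"
  by (rule eq_matI) auto

lemma mat_adjoint_mult:
  fixes A B :: "complex mat"
  assumes "A \<in> carrier_mat m n" "B \<in> carrier_mat n k"
  shows "mat_adjoint (A * B) = mat_adjoint B * mat_adjoint A"
  using assms
  by (intro eq_matI) (auto simp: scalar_prod_def intro!: sum.cong)

lemma mat_adjoint_four_block:
  fixes A B C D :: "complex mat"
  assumes "A \<in> carrier_mat r1 c1" "B \<in> carrier_mat r1 c2" "C \<in> carrier_mat r2 c1" "D \<in> carrier_mat r2 c2"
  shows "mat_adjoint (four_block_mat A B C D) =
    four_block_mat (mat_adjoint A) (mat_adjoint C) (mat_adjoint B) (mat_adjoint D)"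
  using assms by (intro eq_matI) auto

lemma re_inner_sum:
  "v \<in> carrier_vec n \<Longrightarrow> w \<in> carrier_vec n \<Longrightarrow>
    re_inner v w = (\<Sum>i<n. Re (v $ i * cnj (w $ i)))"
  by (simp add: re_inner_def scalar_prod_def atLeast0LessThan)

lemma Re_mult_cnj_self: "Re (z * cnj z) = (cmod z)\<^sup>2"
  by (simp only: complex_mult_cnj) (simp add: cmod_power2)

lemma re_inner_self_sum:
  "v \<in> carrier_vec n \<Longrightarrow> re_inner v v = (\<Sum>i<n. (cmod (v $ i))\<^sup>2)"
  by (simp only: re_inner_sum Re_mult_cnj_self)

lemma cscalar_prod_self: "v \<bullet>c v = complex_of_real (re_inner v v)"
  by (simp add: re_inner_def scalar_prod_def complex_eq_iff)

lemma re_inner_commute: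
  "v \<in> carrier_vec n \<Longrightarrow> w \<in> carrier_vec n \<Longrightarrow> re_inner v w = re_inner w v"
  by (simp add: re_inner_sum algebra_simps)

lemma re_inner_add_left:
  "u \<in> carrier_vec n \<Longrightarrow> v \<in> carrier_vec n \<Longrightarrow> w \<in> carrier_vec n \<Longrightarrow>
    re_inner (u + v) w = re_inner u w + re_inner v w"
  by (simp add: re_inner_sum[of _ n] ring_distribs sum.distrib sum_subtractf)

lemma re_inner_add_right:
  "u \<in> carrier_vec n \<Longrightarrow> v \<in> carrier_vec n \<Longrightarrow> w \<in> carrier_vec n \<Longrightarrow>
    re_inner w (u + v) = re_inner w u + re_inner w v"
  by (simp add: re_inner_sum[of _ n] ring_distribs sum.distrib sum_subtractf)

lemma re_inner_smult_left:
  "v \<in> carrier_vec n \<Longrightarrow> w \<in> carrier_vec n \<Longrightarrow>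
    re_inner (c \<cdot>\<^sub>v v) w = re_inner v (cnj c \<cdot>\<^sub>v w)"
  by (auto simp: re_inner_sum[of _ n] algebra_simps intro!: sum.cong)

lemma re_inner_of_real_left:
  "v \<in> carrier_vec n \<Longrightarrow> w \<in> carrier_vec n \<Longrightarrow>
    re_inner (complex_of_real c \<cdot>\<^sub>v v) w = c * re_inner v w"
  by (simp add: re_inner_sum[of _ n] right_diff_distrib distrib_left sum_distrib_left mult_ac)

lemma re_inner_of_real_right:
  "v \<in> carrier_vec n \<Longrightarrow> w \<in> carrier_vec n \<Longrightarrow>
    re_inner w (complex_of_real c \<cdot>\<^sub>v v) = c * re_inner w v"
  by (simp add: re_inner_sum[of _ n] right_diff_distrib distrib_left sum_distrib_left mult_ac)

lemma re_inner_smult_self: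
  "v \<in> carrier_vec n \<Longrightarrow> re_inner (c \<cdot>\<^sub>v v) (c \<cdot>\<^sub>v v) = (cmod c)\<^sup>2 * re_inner v v"
  by (simp add: re_inner_self_sum[of _ n] norm_mult power_mult_distrib sum_distrib_left)

lemma re_inner_append:
  assumes "a \<in> carrier_vec n" "c \<in> carrier_vec n" "b \<in> carrier_vec k" "d \<in> carrier_vec k"
  shows "re_inner (a @\<^sub>v b) (c @\<^sub>v d) = re_inner a c + re_inner b d"
proof -
  have "conjugate (c @\<^sub>v d) = conjugate c @\<^sub>v conjugate d"
    by (rule eq_vecI) auto
  then show ?thesis
    using scalar_prod_append[of a n b k "conjugate c" "conjugate d"] assms
    by (simp add: re_inner_def)
qed

lemma re_inner_ge_0 [simp]: "re_inner v v \<ge> 0"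
  by (simp add: re_inner_self_sum[of v "dim_vec v"] sum_nonneg)

lemma re_inner_pos: "v \<in> carrier_vec n \<Longrightarrow> v \<noteq> 0\<^sub>v n \<Longrightarrow> re_inner v v > 0"
  using cscalar_prod_self[of v] conjugate_square_eq_0_vec[of v n] re_inner_ge_0[of v]
  by (metis less_eq_real_def of_real_0)

lemma cscalar_prod_adjoint:
  fixes A :: "complex mat"
  assumes "A \<in> carrier_mat m n" "v \<in> carrier_vec n" "w \<in> carrier_vec m"
  shows "(A *\<^sub>v v) \<bullet>c w = v \<bullet>c (mat_adjoint A *\<^sub>v w)"
proof -
  have "(A *\<^sub>v v) \<bullet>c w = (\<Sum>i<m. \<Sum>j<n. A $$ (i,j) * v $ j * cnj (w $ i))"
    using assms by (simp add: scalar_prod_def atLeast0LessThan sum_distrib_right)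
  also have "\<dots> = (\<Sum>j<n. \<Sum>i<m. A $$ (i,j) * v $ j * cnj (w $ i))"
    by (rule sum.swap)
  also have "\<dots> = v \<bullet>c (mat_adjoint A *\<^sub>v w)"
    using assms by (simp add: scalar_prod_def atLeast0LessThan sum_distrib_left mult_ac)
  finally show ?thesis .
qed

lemma re_inner_adjoint:
  "A \<in> carrier_mat m n \<Longrightarrow> v \<in> carrier_vec n \<Longrightarrow> w \<in> carrier_vec m \<Longrightarrow>
    re_inner (A *\<^sub>v v) w = re_inner v (mat_adjoint A *\<^sub>v w)"
  by (simp add: re_inner_def cscalar_prod_adjoint)

text \<open>A nonnegative real quadratic is tested at its minimiser \<open>- b / c\<close>; if
  \<open>c = 0\<close> it is affine, and boundedness below forces \<open>b = 0\<close>.\<close>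

lemma discriminant_le_of_nonneg:
  fixes a b c :: real
  assumes "\<And>t. 0 \<le> a + 2 * t * b + t\<^sup>2 * c" and "c \<ge> 0"
  shows "b\<^sup>2 \<le> a * c"
proof (cases "c = 0")
  case True
  have "b = 0"
  proof (rule ccontr)
    assume "b \<noteq> 0"
    \<comment> \<open>This argument gives the affine function the value -1.\<close>
    then show False using assms(1)[of "- (a + 1) / (2 * b)"] True by (simp add: field_simps)
  qed
  then show ?thesis using True by simp
next
  case False
  then have "c > 0" using assms(2) by simp
  with assms(1)[of "- b / c"] show ?thesis
    by (simp add: power2_eq_square field_simps)
qed

subsection \<open>Positive semidefinite matrices and the spectral theorem\<close>

lemma psd_re_inner:
  "psd M \<Longrightarrow> M \<in> carrier_mat n n \<Longrightarrow> v \<in> carrier_vec n \<Longrightarrow> 0 \<le> re_inner (M *\<^sub>v v) v"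
  by (auto simp: psd_def re_inner_def)

text \<open>The form may be degenerate; the discriminant bound for the real quadratic in
  \<open>t\<close> obtained at \<open>v + t w\<close> covers that case as well. The identity matrix
  gives the usual inequality.\<close>

lemma psd_cauchy_schwarz:
  assumes psd: "psd M" and M: "M \<in> carrier_mat n n"
    and v: "v \<in> carrier_vec n" and w: "w \<in> carrier_vec n"
  shows "(re_inner (M *\<^sub>v v) w)\<^sup>2 \<le> re_inner (M *\<^sub>v v) v * re_inner (M *\<^sub>v w) w"
proof (rule discriminant_le_of_nonneg)
  have herm: "mat_adjoint M = M"
    using psd by (simp add: psd_def)
  show "0 \<le> re_inner (M *\<^sub>v w) w"
    by (rule psd_re_inner[OF psd M w])
  fix t :: real
  let ?t = "complex_of_real t"
  \<comment> \<open>Hermitian symmetry makes the two cross terms equal.\<close>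
  have sym: "re_inner (M *\<^sub>v w) v = re_inner (M *\<^sub>v v) w"
    using re_inner_adjoint[OF M w v] re_inner_commute[of w n "M *\<^sub>v v"] M v w herm by simp
  have "0 \<le> re_inner (M *\<^sub>v (v + ?t \<cdot>\<^sub>v w)) (v + ?t \<cdot>\<^sub>v w)"
    by (rule psd_re_inner[OF psd M]) (use v w in simp)
  also have "M *\<^sub>v (v + ?t \<cdot>\<^sub>v w) = M *\<^sub>v v + ?t \<cdot>\<^sub>v (M *\<^sub>v w)"
    using M v w by (simp add: mult_add_distrib_mat_vec[of _ n n] mult_mat_vec[of _ n n])
  also have "re_inner (M *\<^sub>v v + ?t \<cdot>\<^sub>v (M *\<^sub>v w)) (v + ?t \<cdot>\<^sub>v w) =
      re_inner (M *\<^sub>v v) v + 2 * t * re_inner (M *\<^sub>v v) w + t\<^sup>2 * re_inner (M *\<^sub>v w) w"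
    using M v w
    by (simp add: re_inner_add_left[of _ n] re_inner_add_right[of _ n] re_inner_of_real_left[of _ n]
        re_inner_of_real_right[of _ n] sym power2_eq_square algebra_simps)
  finally show "0 \<le> re_inner (M *\<^sub>v v) v + 2 * t * re_inner (M *\<^sub>v v) w + t\<^sup>2 * re_inner (M *\<^sub>v w) w" .
qed

lemma psd_one: "psd (1\<^sub>m n)"
  using re_inner_ge_0 by (auto simp: psd_def re_inner_def)

lemma re_inner_cauchy_schwarz:
  assumes "v \<in> carrier_vec n" "w \<in> carrier_vec n"
  shows "(re_inner v w)\<^sup>2 \<le> re_inner v v * re_inner w w"
  using psd_cauchy_schwarz[OF psd_one[of n] _ assms] assms by simp

section \<open>Unitary diagonalization of Hermitian matrices\<close>

text \<open>Complete \<open>v\<close> to a basis, orthogonalise and normalise. Gram-Schmidt keeps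
  the head of its list, so the first column stays a multiple of \<open>v\<close>; this splits off an
  eigenvector in the spectral theorem.\<close>

lemma unitary_with_first_column:
  fixes v :: "complex vec"
  assumes v: "v \<in> carrier_vec n" and v0: "v \<noteq> 0\<^sub>v n"
  shows "\<exists>W \<in> carrier_mat n n. mat_adjoint W * W = 1\<^sub>m n \<and> (\<exists>c. col W 0 = c \<cdot>\<^sub>v v)"
proof -
  have n: "n \<noteq> 0" using v v0 by auto
  interpret cof_vec_space n "TYPE(complex)" .
  define b where "b = basis_completion v"
  define ws where "ws = gram_schmidt n b"
  define us where "us = map (\<lambda>w. complex_of_real (1 / sqrt (re_inner w w)) \<cdot>\<^sub>v w) ws"
  define W where "W = mat_of_cols n us"
  from basis_completion[OF v v0, folded b_def]
  have dist_b: "distinct b" and indep: "\<not> lin_dep (set b)" and b: "set b \<subseteq> carrier_vec n"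
    and hdb: "hd b = v" and len_b: "length b = n" by auto
  from hdb len_b n obtain vs where bv: "b = v # vs" by (cases b) auto
  from gram_schmidt_result[OF b dist_b indep refl, folded ws_def]
  have ws: "set ws \<subseteq> carrier_vec n" "corthogonal ws" "length ws = n"
    by (auto simp: len_b)
  have "hd ws = v"
    unfolding ws_def bv by (rule gram_schmidt_hd[OF v])
  then have ws0: "ws ! 0 = v" using ws n by (metis hd_conv_nth list.size(3))
  have W: "W \<in> carrier_mat n n" using ws by (simp add: W_def us_def mat_of_cols_def)
  have wsc: "ws ! i \<in> carrier_vec n" if "i < n" for i using ws that by auto
  have colW: "col W i = complex_of_real (1 / sqrt (re_inner (ws ! i) (ws ! i))) \<cdot>\<^sub>v ws ! i" if "i < n" for i
    using that ws wsc unfolding W_def us_def by (subst col_mat_of_cols) auto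
  have "mat_adjoint W * W = 1\<^sub>m n"
  proof (rule eq_matI)
    fix i j assume "i < dim_row (1\<^sub>m n :: complex mat)" "j < dim_col (1\<^sub>m n :: complex mat)"
    then have ij: "i < n" "j < n" by auto
    have "(mat_adjoint W * W) $$ (i, j) = col W j \<bullet>c col W i"
      using W ij by (auto simp: scalar_prod_def intro!: sum.cong)
    also have "\<dots> = complex_of_real (1 / sqrt (re_inner (ws ! j) (ws ! j))) *
        complex_of_real (1 / sqrt (re_inner (ws ! i) (ws ! i))) * (ws ! j \<bullet>c ws ! i)"
      using wsc[OF ij(1)] wsc[OF ij(2)]
      by (simp add: colW[OF ij(1)] colW[OF ij(2)] conjugate_smult_vec)
    also have "\<dots> = 1\<^sub>m n $$ (i, j)"
    proof (cases "i = j")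
      case True
      have "ws ! i \<bullet>c ws ! i \<noteq> 0" using corthogonalD[OF ws(2), of i i] ij ws(3) by simp
      then have pos: "re_inner (ws ! i) (ws ! i) > 0"
        using cscalar_prod_self[of "ws ! i"] re_inner_ge_0[of "ws ! i"] by (metis less_eq_real_def of_real_0)
      then have "sqrt (re_inner (ws ! i) (ws ! i)) * sqrt (re_inner (ws ! i) (ws ! i)) = re_inner (ws ! i) (ws ! i)"
        by simp
      then show ?thesis using True ij pos
        by (simp add: cscalar_prod_self field_simps flip: of_real_mult)
    next
      case False
      then show ?thesis using corthogonalD[OF ws(2), of j i] ij ws(3) by auto
    qed
    finally show "(mat_adjoint W * W) $$ (i, j) = 1\<^sub>m n $$ (i, j)" .
  qed (use W in auto)
  moreover have "col W 0 = complex_of_real (1 / sqrt (re_inner v v)) \<cdot>\<^sub>v v"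
    using colW[of 0] n ws0 by simp
  ultimately show ?thesis using W by blast
qed

lemma hermitian_congruence:
  fixes A U :: "complex mat"
  assumes "A \<in> carrier_mat n n" "U \<in> carrier_mat n k" "mat_adjoint A = A"
  shows "mat_adjoint (mat_adjoint U * A * U) = mat_adjoint U * A * U"
proof -
  have "mat_adjoint (mat_adjoint U * A * U) = mat_adjoint U * mat_adjoint (mat_adjoint U * A)"
    using assms by (intro mat_adjoint_mult[of _ k n _ k]) auto
  also have "mat_adjoint (mat_adjoint U * A) = A * U"
    using assms by (subst mat_adjoint_mult[of _ k n _ n]) auto
  also have "mat_adjoint U * (A * U) = mat_adjoint U * A * U"
    using assms by (intro assoc_mult_mat[symmetric, of _ k n _ n _ k]) auto
  finally show ?thesis .
qed

lemma adjoint_mult_congruence: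
  fixes A P Q :: "complex mat"
  assumes A: "A \<in> carrier_mat m m" and P: "P \<in> carrier_mat m n" and Q: "Q \<in> carrier_mat n k"
  shows "mat_adjoint (P * Q) * A * (P * Q) = mat_adjoint Q * (mat_adjoint P * A * P) * Q"
proof -
  note P' = mat_adjoint_carrier[OF P] and Q' = mat_adjoint_carrier[OF Q]
  note PA = mult_carrier_mat[OF P' A]
  have "mat_adjoint (P * Q) * A * (P * Q) = mat_adjoint Q * (mat_adjoint P * A) * (P * Q)"
    by (simp add: mat_adjoint_mult[OF P Q] assoc_mult_mat[OF Q' P' A])
  also have "\<dots> = mat_adjoint Q * ((mat_adjoint P * A) * P * Q)"
    by (simp add: assoc_mult_mat[OF Q' PA mult_carrier_mat[OF P Q]] assoc_mult_mat[OF PA P Q])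
  also have "\<dots> = mat_adjoint Q * (mat_adjoint P * A * P) * Q"
    by (rule assoc_mult_mat[OF Q' mult_carrier_mat[OF PA P] Q, symmetric])
  finally show ?thesis .
qed

lemma adjoint_mult_self:
  fixes P Q :: "complex mat"
  assumes P: "P \<in> carrier_mat m n" and Q: "Q \<in> carrier_mat n k"
  shows "mat_adjoint (P * Q) * (P * Q) = mat_adjoint Q * (mat_adjoint P * P) * Q"
proof -
  have "mat_adjoint (P * Q) * 1\<^sub>m m = mat_adjoint (P * Q)" "mat_adjoint P * 1\<^sub>m m = mat_adjoint P"
    using P Q by auto
  then show ?thesis using adjoint_mult_congruence[OF one_carrier_mat P Q] by simp
qed

text \<open>The spectral theorem by deflation, with induction on the list of eigenvalues. The order
  of \<open>es\<close> is prescribed and reappears on the diagonal, so a sorted list later yields a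
  basis ordered by singular value.\<close>

lemma hermitian_diagonalization:
  fixes A :: "complex mat"
  assumes "A \<in> carrier_mat n n" and "mat_adjoint A = A"
    and "char_poly A = (\<Prod>e\<leftarrow>es. [:- e, 1:])"
  shows "\<exists>U \<in> carrier_mat n n. mat_adjoint U * U = 1\<^sub>m n \<and>
    mat_adjoint U * A * U = mat_diag n (\<lambda>i. es ! i)"
  using assms
proof (induction es arbitrary: n A)
  case Nil
  then have "n = 0" using degree_monic_char_poly[of A n] by simp
  then show ?case using Nil by (intro bexI[of _ "1\<^sub>m 0"]) (auto simp: mat_diag_def)
next
  case (Cons e es n A)
  note A = Cons.prems(1) and herm = Cons.prems(2)
  have cp: "char_poly A = [:- e, 1:] * (\<Prod>e\<leftarrow>es. [:- e, 1:])"
    using Cons.prems(3) by simp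
  have "eigenvalue A e"
    unfolding eigenvalue_root_char_poly[OF A] cp by simp
  from find_eigenvector[OF A this] obtain v where v: "v \<in> carrier_vec n" "v \<noteq> 0\<^sub>v n"
    and Av: "A *\<^sub>v v = e \<cdot>\<^sub>v v"
    using A unfolding eigenvector_def by auto
  have n: "n \<noteq> 0" using v by auto
  then obtain k where k: "n = Suc k" by (cases n) auto
  obtain W c where W: "W \<in> carrier_mat n n" and WW: "mat_adjoint W * W = 1\<^sub>m n"
    and Wc: "col W 0 = c \<cdot>\<^sub>v v"
    using unitary_with_first_column[OF v] by blast
  have WW': "W * mat_adjoint W = 1\<^sub>m n"
    by (rule mat_mult_left_right_inverse[OF _ W WW]) (use W in auto)
  \<comment> \<open>In the new basis the first basis vector is an eigenvector, so the first column
    of \<open>A'\<close> is \<open>e\<close> times a unit vector. Hermitian symmetry gives the same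
    for the first row and makes \<open>e\<close> real.\<close>
  define A' where "A' = mat_adjoint W * A * W"
  have A': "A' \<in> carrier_mat n n" using W A by (auto simp: A'_def)
  have herm': "mat_adjoint A' = A'"
    unfolding A'_def by (rule hermitian_congruence[OF A W herm])
  have AWc: "A *\<^sub>v col W 0 = e \<cdot>\<^sub>v col W 0"
    using A v Av by (simp add: Wc mult_mat_vec[of A n n] smult_smult_assoc mult.commute)
  have col0: "A' $$ (i, 0) = (if i = 0 then e else 0)" if i: "i < n" for i
  proof -
    have "A' $$ (i, 0) = (mat_adjoint W * (A * W)) $$ (i, 0)"
      unfolding A'_def using W A by (simp add: assoc_mult_mat[of _ n n _ n _ n])
    also have "\<dots> = row (mat_adjoint W) i \<bullet> (A *\<^sub>v col W 0)"
      using W A i n col_mult2[of A n n W n 0] by (simp del: col_mult2)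
    also have "\<dots> = e * (mat_adjoint W * W) $$ (i, 0)"
      unfolding AWc using W i n by simp
    finally show ?thesis using i n by (simp add: WW)
  qed
  have row0: "A' $$ (0, i) = (if i = 0 then cnj e else 0)" if i: "i < n" for i
    using arg_cong[OF herm', of "\<lambda>M. M $$ (0, i)"] col0[OF i] i n A' by (auto split: if_splits)
  have "cnj e = e" using row0[of 0] col0[of 0] n by simp
  define A3 where "A3 = mat k k (\<lambda>(i, j). A' $$ (Suc i, Suc j))"
  have A3: "A3 \<in> carrier_mat k k" by (simp add: A3_def)
  let ?e = "mat 1 1 (\<lambda>_. e)"
  have A'_block: "A' = four_block_mat ?e (0\<^sub>m 1 k) (0\<^sub>m k 1) A3"
    using A' col0 row0 \<open>cnj e = e\<close> by (intro eq_matI) (auto simp: A3_def k less_Suc_eq_0_disj)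
  have "similar_mat_wit A' A (mat_adjoint W) W"
    by (rule similar_mat_witI[of _ _ n]) (use W A A' WW WW' in \<open>auto simp: A'_def\<close>)
  then have "char_poly A' = char_poly A"
    using char_poly_similar similar_mat_def by blast
  moreover have "char_poly A' = char_poly ?e * char_poly A3"
    unfolding A'_block by (rule char_poly_four_block_zeros_col) (use A3 in auto)
  moreover have "char_poly ?e = [:- e, 1:]"
    by (simp add: char_poly_defs det_def sign_def)
  \<comment> \<open>Cancelling the linear factor of \<open>e\<close> leaves the factorization that
    the induction hypothesis needs for the smaller block.\<close>
  ultimately have cp3: "char_poly A3 = (\<Prod>e\<leftarrow>es. [:- e, 1:])"
    unfolding cp by (metis mult_cancel_left pCons_eq_0_iff zero_neq_one)
  have herm3: "mat_adjoint A3 = A3"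
  proof (rule eq_matI)
    fix i j assume "i < dim_row A3" "j < dim_col A3"
    then show "mat_adjoint A3 $$ (i, j) = A3 $$ (i, j)"
      using arg_cong[OF herm', of "\<lambda>M. M $$ (Suc i, Suc j)"] A' by (simp add: A3_def k)
  qed (auto simp: A3_def)
  from Cons.IH[OF A3 herm3 cp3] obtain U where U: "U \<in> carrier_mat k k"
    and UU: "mat_adjoint U * U = 1\<^sub>m k" and UAU: "mat_adjoint U * A3 * U = mat_diag k (\<lambda>i. es ! i)"
    by blast
  \<comment> \<open>The diagonalizing matrix of the small block, extended by 1 in the corner that is
    already diagonal.\<close>
  define V where "V = four_block_mat (1\<^sub>m 1) (0\<^sub>m 1 k) (0\<^sub>m k 1) U"
  have V: "V \<in> carrier_mat n n" unfolding V_def k using U by auto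
  have zero: "mat_adjoint (0\<^sub>m a b :: complex mat) = 0\<^sub>m b a" for a b
    by (rule eq_matI) auto
  have adjV: "mat_adjoint V = four_block_mat (1\<^sub>m 1) (0\<^sub>m 1 k) (0\<^sub>m k 1) (mat_adjoint U)"
    unfolding V_def by (subst mat_adjoint_four_block[of _ 1 1 _ k _ k]) (use U in \<open>auto simp: zero\<close>)
  have VV: "mat_adjoint V * V = 1\<^sub>m n"
    unfolding adjV unfolding V_def
    by (subst mult_four_block_mat[of _ 1 1 _ k _ k _ _ 1 _ k]) (use U UU in \<open>auto simp: k\<close>)
  have "mat_adjoint V * A' = four_block_mat ?e (0\<^sub>m 1 k) (0\<^sub>m k 1) (mat_adjoint U * A3)"
    unfolding adjV unfolding A'_block
    by (subst mult_four_block_mat[of _ 1 1 _ k _ k _ _ 1 _ k]) (use U A3 in \<open>auto simp: k\<close>)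
  then have "mat_adjoint V * A' * V =
      four_block_mat ?e (0\<^sub>m 1 k) (0\<^sub>m k 1) (mat_adjoint U * A3) * V" by simp
  also have "\<dots> = four_block_mat ?e (0\<^sub>m 1 k) (0\<^sub>m k 1) (mat_adjoint U * A3 * U)"
    unfolding V_def
    by (subst mult_four_block_mat[of _ 1 1 _ k _ k _ _ 1 _ k]) (use U A3 in \<open>auto simp: k\<close>)
  also have "\<dots> = mat_diag n (\<lambda>i. (e # es) ! i)"
    unfolding UAU by (rule eq_matI) (auto simp: k mat_diag_def nth_Cons')
  finally have VAV: "mat_adjoint V * A' * V = mat_diag n (\<lambda>i. (e # es) ! i)" .
  have "mat_adjoint (W * V) * (W * V) = 1\<^sub>m n"
    using V VV by (simp add: adjoint_mult_self[OF W V] WW right_mult_one_mat[of _ n n])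
  moreover have "mat_adjoint (W * V) * A * (W * V) = mat_adjoint V * A' * V"
    unfolding A'_def by (rule adjoint_mult_congruence[OF A W V])
  ultimately show ?case using W V VAV by (intro bexI[of _ "W * V"]) auto
qed

subsection \<open>Variational properties of singular values\<close>

lemma re_inner_mult_right:
  assumes "P \<in> carrier_mat m n" "v \<in> carrier_vec n" "w \<in> carrier_vec n"
  shows "re_inner (P *\<^sub>v v) (P *\<^sub>v w) = re_inner v ((mat_adjoint P * P) *\<^sub>v w)"
  using assms by (subst re_inner_adjoint[of P m n]) (auto simp: assoc_mult_mat_vec[of _ n m])

lemma isometry_re_inner:
  assumes "P \<in> carrier_mat m n" "mat_adjoint P * P = 1\<^sub>m n" "v \<in> carrier_vec n" "w \<in> carrier_vec n"
  shows "re_inner (P *\<^sub>v v) (P *\<^sub>v w) = re_inner v w"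
  using assms by (simp add: re_inner_mult_right[of P m n])

text \<open>Connects the definition through a multiset of roots with an orthonormal basis:
  diagonalizing the Gram matrix with its eigenvalues in decreasing order makes the columns of
  \<open>M * V\<close> orthogonal, the \<open>i\<close>-th having norm
  \<open>singular_values M ! i\<close>.\<close>

lemma singular_values_diagonalization:
  assumes M: "M \<in> carrier_mat m n"
  shows "sorted_wrt (\<ge>) (singular_values M)"
    and "\<forall>s \<in> set (singular_values M). 0 \<le> s"
    and "\<exists>V \<in> carrier_mat n n. mat_adjoint V * V = 1\<^sub>m n \<and>
      mat_adjoint (M * V) * (M * V) =
        mat_diag n (\<lambda>i. complex_of_real ((singular_values M ! i)\<^sup>2))"
proof -
  define G where "G = mat_adjoint M * M"
  have G: "G \<in> carrier_mat n n" using M by (auto simp: G_def)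
  have herm: "mat_adjoint G = G"
    using M by (simp add: G_def mat_adjoint_mult[of _ n m _ n])
  obtain as where cp: "char_poly G = (\<Prod>a\<leftarrow>as. [:- a, 1:])" and len: "length as = n"
    using char_poly_factorized[OF G] by blast
  \<comment> \<open>Complex numbers are sorted by real part; the eigenvalues are shown below to be
    real, so this is their decreasing order.\<close>
  define es where "es = rev (sort_key Re as)"
  have mset_es: "mset es = mset as" by (simp add: es_def)
  have len_es: "length es = n" by (simp add: es_def len)
  have cp_es: "char_poly G = (\<Prod>a\<leftarrow>es. [:- a, 1:])"
    unfolding cp prod_mset_prod_list[symmetric] mset_map mset_es ..
  obtain V where V: "V \<in> carrier_mat n n" and VV: "mat_adjoint V * V = 1\<^sub>m n"
    and VGV: "mat_adjoint V * G * V = mat_diag n (\<lambda>i. es ! i)"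
    using hermitian_diagonalization[OF G herm cp_es] by blast
  have gram: "mat_adjoint (M * V) * (M * V) = mat_diag n (\<lambda>i. es ! i)"
    unfolding adjoint_mult_self[OF M V] G_def[symmetric] by (rule VGV)
  \<comment> \<open>A diagonal entry of the Gram matrix of \<open>M * V\<close> is the squared norm
    of a column.\<close>
  have es_nonneg: "es ! i = complex_of_real (Re (es ! i)) \<and> 0 \<le> Re (es ! i)" if i: "i < n" for i
  proof -
    have "es ! i = (mat_adjoint (M * V) * (M * V)) $$ (i, i)"
      using i by (simp add: gram mat_diag_def)
    also have "\<dots> = col (M * V) i \<bullet>c col (M * V) i"
      using M V i by (simp add: scalar_prod_def) (auto intro!: sum.cong simp: mult.commute)
    also have "\<dots> = complex_of_real (re_inner (col (M * V) i) (col (M * V) i))"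
      by (rule cscalar_prod_self)
    finally show ?thesis by simp
  qed
  have "proots (\<Prod>a\<leftarrow>xs. [:- a, 1:]) = mset xs" for xs :: "complex list"
  proof (induction xs)
    case (Cons x xs)
    have "(\<Prod>a\<leftarrow>xs. [:- a, 1:]) \<noteq> (0 :: complex poly)" by auto
    then have "proots ([:- x, 1:] * (\<Prod>a\<leftarrow>xs. [:- a, 1:])) = {#x#} + mset xs"
      by (subst proots_mult) (auto simp: Cons.IH)
    then show ?case by simp
  qed simp
  then have "proots (char_poly G) = mset es" by (simp add: cp_es)
  have "sorted (map (\<lambda>z. sqrt (Re z)) (rev es))"
    by (simp add: es_def sorted_map) (metis (no_types, lifting) sorted_map sorted_sort_key sorted_wrt_mono_rel)
  then have "sort (map (\<lambda>z. sqrt (Re z)) es) = map (\<lambda>z. sqrt (Re z)) (rev es)"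
    by (intro properties_for_sort) auto
  then have sv: "singular_values M = map (\<lambda>z. sqrt (Re z)) es"
    unfolding singular_values_def G_def[symmetric] \<open>proots (char_poly G) = mset es\<close>
    by (simp add: rev_map flip: mset_map)
  show "sorted_wrt (\<ge>) (singular_values M)"
    using \<open>sorted (map (\<lambda>z. sqrt (Re z)) (rev es))\<close> unfolding sv
    by (simp add: sorted_wrt_rev flip: rev_map)
  show "\<forall>s \<in> set (singular_values M). 0 \<le> s"
    using es_nonneg by (auto simp: sv in_set_conv_nth len_es)
  have "mat_diag n (\<lambda>i. es ! i) = mat_diag n (\<lambda>i. complex_of_real ((singular_values M ! i)\<^sup>2))"
  proof -
    have "es ! i = complex_of_real ((singular_values M ! i)\<^sup>2)" if "i < n" for i
      using es_nonneg[OF that] that by (simp add: sv len_es del: of_real_power)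
    then show ?thesis by (intro eq_matI) (auto simp: mat_diag_def simp del: of_real_power)
  qed
  then show "\<exists>V \<in> carrier_mat n n. mat_adjoint V * V = 1\<^sub>m n \<and>
      mat_adjoint (M * V) * (M * V) =
        mat_diag n (\<lambda>i. complex_of_real ((singular_values M ! i)\<^sup>2))"
    using V VV gram by auto
qed

lemma sing_val_nonneg:
  assumes "M \<in> carrier_mat m n" "1 \<le> j" "j \<le> n"
  shows "0 \<le> sing_val j M"
  using singular_values_diagonalization(2)[OF assms(1)] assms length_singular_values[of M]
  by (auto simp: sing_val_def)

lemma sing_val_antimono:
  assumes "M \<in> carrier_mat m n" "1 \<le> i" "i \<le> j" "j \<le> n"
  shows "sing_val j M \<le> sing_val i M"
proof (cases "i = j")
  case False
  then show ?thesis
    using sorted_wrt_nth_less[OF singular_values_diagonalization(1)[OF assms(1)], of "i - 1" "j - 1"]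
      assms length_singular_values[of M]
    by (simp add: sing_val_def)
qed simp

text \<open>The columns of \<open>V\<close> are right singular vectors. In their coordinates the
  form of the Gram matrix is diagonal with weights sigma^2, the shape in which the later estimates
  use the decomposition; \<open>Suc i\<close> translates list indices into the numbering from
  1.\<close>

lemma singular_basis:
  assumes M: "M \<in> carrier_mat m n"
  obtains V where "V \<in> carrier_mat n n" "mat_adjoint V * V = 1\<^sub>m n" "V * mat_adjoint V = 1\<^sub>m n"
    "\<And>c d. c \<in> carrier_vec n \<Longrightarrow> d \<in> carrier_vec n \<Longrightarrow>
      re_inner (M *\<^sub>v (V *\<^sub>v c)) (M *\<^sub>v (V *\<^sub>v d)) =
        (\<Sum>i<n. (sing_val (Suc i) M)\<^sup>2 * Re (c $ i * cnj (d $ i)))"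
proof -
  from singular_values_diagonalization(3)[OF M] obtain V where V: "V \<in> carrier_mat n n"
    and VV: "mat_adjoint V * V = 1\<^sub>m n" and gram: "mat_adjoint (M * V) * (M * V) =
        mat_diag n (\<lambda>i. complex_of_real ((singular_values M ! i)\<^sup>2))" by blast
  have "V * mat_adjoint V = 1\<^sub>m n"
    by (rule mat_mult_left_right_inverse[OF _ V VV]) (use V in auto)
  moreover have "re_inner (M *\<^sub>v (V *\<^sub>v c)) (M *\<^sub>v (V *\<^sub>v d)) =
        (\<Sum>i<n. (sing_val (Suc i) M)\<^sup>2 * Re (c $ i * cnj (d $ i)))"
    if c: "c \<in> carrier_vec n" and d: "d \<in> carrier_vec n" for c d
  proof -
    define s where "s i = complex_of_real ((singular_values M ! i)\<^sup>2)" for i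
    have diag: "mat_diag n s *\<^sub>v d = vec n (\<lambda>i. s i * d $ i)"
    proof (rule eq_vecI)
      fix i assume "i < dim_vec (vec n (\<lambda>i. s i * d $ i))"
      then have i: "i < n" by simp
      have "(mat_diag n s *\<^sub>v d) $ i = (\<Sum>k<n. (if i = k then s k else 0) * d $ k)"
        using i d by (simp add: mat_diag_def scalar_prod_def atLeast0LessThan)
      also have "\<dots> = (\<Sum>k<n. if i = k then s k * d $ k else 0)"
        by (intro sum.cong) auto
      finally show "(mat_diag n s *\<^sub>v d) $ i = vec n (\<lambda>i. s i * d $ i) $ i"
        using i by simp
    qed (simp add: mat_diag_def)
    have "re_inner (M *\<^sub>v (V *\<^sub>v c)) (M *\<^sub>v (V *\<^sub>v d)) = re_inner ((M * V) *\<^sub>v c) ((M * V) *\<^sub>v d)"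
      using M V c d by (simp add: assoc_mult_mat_vec[of _ m n _ n])
    also have "\<dots> = re_inner c (vec n (\<lambda>i. s i * d $ i))"
      by (simp only: re_inner_mult_right[OF mult_carrier_mat[OF M V] c d] gram diag flip: s_def)
    also have "\<dots> = (\<Sum>i<n. (sing_val (Suc i) M)\<^sup>2 * Re (c $ i * cnj (d $ i)))"
      using c by (subst re_inner_sum[of _ n]) (auto simp: sing_val_def s_def algebra_simps intro!: sum.cong)
    finally show ?thesis .
  qed
  ultimately show thesis using V VV that by blast
qed

section \<open>Lower bounds for singular values and frames of singular vectors\<close>

text \<open>There are more unknowns than equations. Padding \<open>D\<close> with zero rows gives a
  square matrix whose last row vanishes, hence one with determinant zero.\<close>

lemma exists_kernel_vec:
  fixes D :: "complex mat"
  assumes D: "D \<in> carrier_mat k j" and "k < j"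
  shows "\<exists>c \<in> carrier_vec j. c \<noteq> 0\<^sub>v j \<and> D *\<^sub>v c = 0\<^sub>v k"
proof -
  define E where "E = mat j j (\<lambda>(i, l). if i < k then D $$ (i, l) else 0)"
  have E: "E \<in> carrier_mat j j" by (simp add: E_def)
  have "transpose_mat E *\<^sub>v unit_vec j (j - 1) = 0\<^sub>v j"
    using \<open>k < j\<close> by (intro eq_vecI) (auto simp: E_def)
  moreover have "unit_vec j (j - 1) \<noteq> (0\<^sub>v j :: complex vec)"
    using \<open>k < j\<close> by simp
  ultimately have "det (transpose_mat E) = 0"
    using det_0_iff_vec_prod_zero[of "transpose_mat E" j] E unit_vec_carrier[of j "j - 1"]
    by (metis transpose_carrier_mat)
  then have "det E = 0" using det_transpose[OF E] by simp
  then obtain c where c: "c \<in> carrier_vec j" "c \<noteq> 0\<^sub>v j" and Ec: "E *\<^sub>v c = 0\<^sub>v j"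
    using det_0_iff_vec_prod_zero[OF E] by blast
  have "D *\<^sub>v c = 0\<^sub>v k"
  proof (rule eq_vecI)
    fix i assume "i < dim_vec (0\<^sub>v k :: complex vec)"
    then have "i < k" by simp
    then show "(D *\<^sub>v c) $ i = 0\<^sub>v k $ i"
      using arg_cong[OF Ec, of "\<lambda>v. v $ i"] D c(1) \<open>k < j\<close>
      by (simp add: E_def scalar_prod_def)
  qed (use D in simp)
  then show ?thesis using c by blast
qed

text \<open>One half of the Courant-Fischer principle. The range of \<open>Y\<close> has dimension
  \<open>j\<close>, so it meets the span of the right singular vectors from the \<open>j\<close>-th
  on in a nonzero vector, and there \<open>M\<close> stretches by at most sigma_j.\<close>

lemma sing_val_ge:
  assumes M: "M \<in> carrier_mat m n" and j: "1 \<le> j" "j \<le> n" and Y: "Y \<in> carrier_mat n j"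
    and inj: "\<And>c. c \<in> carrier_vec j \<Longrightarrow> c \<noteq> 0\<^sub>v j \<Longrightarrow> Y *\<^sub>v c \<noteq> 0\<^sub>v n"
    and ge: "\<And>c. c \<in> carrier_vec j \<Longrightarrow>
      s\<^sup>2 * re_inner (Y *\<^sub>v c) (Y *\<^sub>v c) \<le> re_inner (M *\<^sub>v (Y *\<^sub>v c)) (M *\<^sub>v (Y *\<^sub>v c))"
  shows "s \<le> sing_val j M"
proof (rule ccontr)
  assume "\<not> s \<le> sing_val j M"
  moreover have nonneg: "0 \<le> sing_val j M" by (rule sing_val_nonneg[OF M j])
  ultimately have less: "(sing_val j M)\<^sup>2 < s\<^sup>2"
    by (intro power_strict_mono) auto
  obtain V where V: "V \<in> carrier_mat n n" and VV: "mat_adjoint V * V = 1\<^sub>m n"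
    and VV': "V * mat_adjoint V = 1\<^sub>m n"
    and inner: "\<And>c d. c \<in> carrier_vec n \<Longrightarrow> d \<in> carrier_vec n \<Longrightarrow>
      re_inner (M *\<^sub>v (V *\<^sub>v c)) (M *\<^sub>v (V *\<^sub>v d)) =
        (\<Sum>i<n. (sing_val (Suc i) M)\<^sup>2 * Re (c $ i * cnj (d $ i)))"
    by (rule singular_basis[OF M]) (rule that)
  \<comment> \<open>The \<open>j - 1\<close> equations \<open>D c = 0\<close> say that
    \<open>Y c\<close> has vanishing coordinates along the first \<open>j - 1\<close> right singular
    vectors; for \<open>j = 1\<close> there is no equation.\<close>
  define D where "D = mat (j - 1) j (\<lambda>(i, l). (mat_adjoint V * Y) $$ (i, l))"
  have "D \<in> carrier_mat (j - 1) j" by (simp add: D_def)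
  from exists_kernel_vec[OF this] j obtain c where c: "c \<in> carrier_vec j" "c \<noteq> 0\<^sub>v j"
    and Dc: "D *\<^sub>v c = 0\<^sub>v (j - 1)" by auto
  define y where "y = Y *\<^sub>v c"
  define d where "d = mat_adjoint V *\<^sub>v y"
  have y: "y \<in> carrier_vec n" using Y c by (simp add: y_def)
  have d: "d \<in> carrier_vec n" using V y by (simp add: d_def)
  have yd: "y = V *\<^sub>v d"
    using V y unfolding d_def by (subst assoc_mult_mat_vec[symmetric, of _ n n _ n]) (auto simp: VV')
  have d0: "d $ i = 0" if "i < j - 1" for i
  proof -
    have "d = (mat_adjoint V * Y) *\<^sub>v c"
      using V Y c unfolding d_def y_def by (subst assoc_mult_mat_vec[of _ n n _ j]) auto
    then have "d $ i = (D *\<^sub>v c) $ i"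
      using that j V Y c by (simp add: D_def scalar_prod_def)
    then show ?thesis using that Dc by simp
  qed
  have "re_inner (M *\<^sub>v y) (M *\<^sub>v y) = (\<Sum>i<n. (sing_val (Suc i) M)\<^sup>2 * (cmod (d $ i))\<^sup>2)"
    unfolding yd inner[OF d d] by (simp only: Re_mult_cnj_self)
  also have "\<dots> \<le> (\<Sum>i<n. (sing_val j M)\<^sup>2 * (cmod (d $ i))\<^sup>2)"
  proof (rule sum_mono)
    fix i assume "i \<in> {..<n}"
    then have i: "i < n" by simp
    show "(sing_val (Suc i) M)\<^sup>2 * (cmod (d $ i))\<^sup>2 \<le> (sing_val j M)\<^sup>2 * (cmod (d $ i))\<^sup>2"
    proof (cases "i < j - 1")
      case True
      then show ?thesis by (simp add: d0)
    next
      case False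
      \<comment> \<open>Here \<open>Suc i\<close> is at least \<open>j\<close>, so monotonicity of
        the singular values applies.\<close>
      then have "(sing_val (Suc i) M)\<^sup>2 \<le> (sing_val j M)\<^sup>2"
        using sing_val_antimono[OF M, of j "Suc i"] sing_val_nonneg[OF M, of "Suc i"] i j
        by (intro power_mono) auto
      then show ?thesis by (intro mult_right_mono) auto
    qed
  qed
  also have "\<dots> = (sing_val j M)\<^sup>2 * re_inner d d"
    using d by (simp add: re_inner_self_sum[of _ n] sum_distrib_left)
  also have "re_inner d d = re_inner y y"
    unfolding yd by (rule isometry_re_inner[OF V VV d d, symmetric])
  finally have "re_inner (M *\<^sub>v y) (M *\<^sub>v y) \<le> (sing_val j M)\<^sup>2 * re_inner y y" .
  moreover have "re_inner y y > 0"
    using re_inner_pos[OF y] inj[OF c] by (simp add: y_def)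
  ultimately show False
    using ge[OF c(1)] less by (simp add: y_def) (smt (verit) mult_strict_right_mono)
qed

text \<open>The columns of \<open>Y\<close> and \<open>Z\<close> are the first \<open>j\<close>
  right and left singular vectors, so sending \<open>Y c\<close> to \<open>Z c\<close> is the
  partial isometry between their spans. Positivity of sigma_j permits writing the left vectors as M
  v_i / sigma_i.\<close>

lemma sing_val_frame:
  assumes M: "M \<in> carrier_mat m n" and j: "1 \<le> j" "j \<le> n" and pos: "0 < sing_val j M"
  obtains Y Z where "Y \<in> carrier_mat n j" "Z \<in> carrier_mat m j"
    "\<And>c. c \<in> carrier_vec j \<Longrightarrow> re_inner (Y *\<^sub>v c) (Y *\<^sub>v c) = re_inner c c"
    "\<And>c. c \<in> carrier_vec j \<Longrightarrow> re_inner (Z *\<^sub>v c) (Z *\<^sub>v c) = re_inner c c"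
    "\<And>c. c \<in> carrier_vec j \<Longrightarrow> sing_val j M * re_inner c c \<le> re_inner (M *\<^sub>v (Y *\<^sub>v c)) (Z *\<^sub>v c)"
proof -
  obtain V where V: "V \<in> carrier_mat n n" and VV: "mat_adjoint V * V = 1\<^sub>m n"
    and inner: "\<And>c d. c \<in> carrier_vec n \<Longrightarrow> d \<in> carrier_vec n \<Longrightarrow>
      re_inner (M *\<^sub>v (V *\<^sub>v c)) (M *\<^sub>v (V *\<^sub>v d)) =
        (\<Sum>i<n. (sing_val (Suc i) M)\<^sup>2 * Re (c $ i * cnj (d $ i)))"
    by (rule singular_basis[OF M]) (rule that)
  \<comment> \<open>\<open>E g\<close> embeds \<open>j\<close> coordinates into dimension
    \<open>n\<close>, scaling the \<open>i\<close>-th by \<open>g i\<close>.\<close>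
  define E where "E g = mat n j (\<lambda>(i, l). if i = l then complex_of_real (g i) else 0)" for g
  have E: "E g \<in> carrier_mat n j" for g by (simp add: E_def)
  have Ec: "E g *\<^sub>v c \<in> carrier_vec n" if "c \<in> carrier_vec j" for g c
    using mult_mat_vec_carrier[OF E that] .
  have E_index: "(E g *\<^sub>v c) $ i = (if i < j then g i * c $ i else 0)"
    if c: "c \<in> carrier_vec j" and i: "i < n" for g c i
  proof -
    have "(E g *\<^sub>v c) $ i = (\<Sum>l<j. (if i = l then complex_of_real (g i) else 0) * c $ l)"
      using c i by (simp add: E_def scalar_prod_def atLeast0LessThan)
    also have "\<dots> = (\<Sum>l<j. if i = l then g i * c $ l else 0)"
      by (intro sum.cong) auto
    finally show ?thesis by simp
  qed
  have restrict: "(\<Sum>i<n. if i < j then f i else 0) = (\<Sum>i<j. f i)" for f :: "nat \<Rightarrow> real"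
    using j by (simp add: sum.If_cases) (rule sum.cong, auto)
  let ?s = "\<lambda>i. sing_val (Suc i) M"
  have s_ge: "sing_val j M \<le> ?s i" if "i < j" for i
    using sing_val_antimono[OF M, of "Suc i" j] that j by simp
  define Y where "Y = V * E (\<lambda>_. 1)"
  define Z where "Z = M * (V * E (\<lambda>i. 1 / ?s i))"
  have Yc: "Y *\<^sub>v c = V *\<^sub>v (E (\<lambda>_. 1) *\<^sub>v c)" if "c \<in> carrier_vec j" for c
    using V E that unfolding Y_def by (intro assoc_mult_mat_vec) auto
  have Zc: "Z *\<^sub>v c = M *\<^sub>v (V *\<^sub>v (E (\<lambda>i. 1 / ?s i) *\<^sub>v c))" if "c \<in> carrier_vec j" for c
    using V E M that unfolding Z_def
    by (subst assoc_mult_mat_vec[of _ m n _ j]) (auto intro!: arg_cong[of _ _ "(*\<^sub>v) M"] assoc_mult_mat_vec)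
  show thesis
  proof (rule that[of Y Z])
    show "Y \<in> carrier_mat n j" "Z \<in> carrier_mat m j"
      using V E M by (auto simp: Y_def Z_def)
    fix c :: "complex vec" assume c: "c \<in> carrier_vec j"
    have "re_inner (Y *\<^sub>v c) (Y *\<^sub>v c) = re_inner (E (\<lambda>_. 1) *\<^sub>v c) (E (\<lambda>_. 1) *\<^sub>v c)"
      unfolding Yc[OF c] by (rule isometry_re_inner[OF V VV Ec[OF c] Ec[OF c]])
    also have "\<dots> = (\<Sum>i<n. if i < j then (cmod (c $ i))\<^sup>2 else 0)"
      by (subst re_inner_self_sum[OF Ec[OF c]]) (auto simp: E_index[OF c] intro!: sum.cong)
    finally show "re_inner (Y *\<^sub>v c) (Y *\<^sub>v c) = re_inner c c"
      using c by (simp add: restrict re_inner_self_sum)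
    have "re_inner (Z *\<^sub>v c) (Z *\<^sub>v c) = (\<Sum>i<n. if i < j then (cmod (c $ i))\<^sup>2 else 0)"
      unfolding Zc[OF c] inner[OF Ec[OF c] Ec[OF c]]
    proof (rule sum.cong)
      fix i assume "i \<in> {..<n}"
      then have i: "i < n" by simp
      let ?z = "(E (\<lambda>i. 1 / ?s i) *\<^sub>v c) $ i"
      have "Re (?z * cnj ?z) = (cmod ?z)\<^sup>2" by (rule Re_mult_cnj_self)
      moreover have "(?s i)\<^sup>2 * (cmod ?z)\<^sup>2 = (if i < j then (cmod (c $ i))\<^sup>2 else 0)"
        using s_ge[of i] pos i
        by (auto simp: E_index[OF c i] norm_divide power_divide)
      ultimately show "(?s i)\<^sup>2 * Re (?z * cnj ?z) = (if i < j then (cmod (c $ i))\<^sup>2 else 0)" by simp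
    qed simp
    then show "re_inner (Z *\<^sub>v c) (Z *\<^sub>v c) = re_inner c c"
      using c by (simp add: restrict re_inner_self_sum)
    \<comment> \<open>The weights sigma_i^2 and 1 / sigma_i combine to sigma_i, which is at least
      sigma_j for the indices that remain.\<close>
    have "re_inner (M *\<^sub>v (Y *\<^sub>v c)) (Z *\<^sub>v c) = (\<Sum>i<n. if i < j then ?s i * (cmod (c $ i))\<^sup>2 else 0)"
      unfolding Zc[OF c] Yc[OF c] inner[OF Ec[OF c] Ec[OF c]]
    proof (rule sum.cong)
      fix i assume "i \<in> {..<n}"
      then have i: "i < n" by simp
      show "(?s i)\<^sup>2 * Re ((E (\<lambda>_. 1) *\<^sub>v c) $ i * cnj ((E (\<lambda>i. 1 / ?s i) *\<^sub>v c) $ i)) =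
          (if i < j then ?s i * (cmod (c $ i))\<^sup>2 else 0)"
      proof (cases "i < j")
        case True
        have Re_real: "Re (complex_of_real r * w) = r * Re w" for r w by simp
        have "Re (c $ i * cnj (complex_of_real (1 / ?s i) * c $ i)) = (1 / ?s i) * (cmod (c $ i))\<^sup>2"
          by (simp only: complex_cnj_mult complex_cnj_complex_of_real mult.left_commute[of "c $ i"]
              Re_real Re_mult_cnj_self)
        then show ?thesis
          using True s_ge[OF True] pos by (simp add: E_index[OF c i] power2_eq_square)
      qed (simp add: E_index[OF c i])
    qed simp
    also have "\<dots> = (\<Sum>i<j. ?s i * (cmod (c $ i))\<^sup>2)" by (rule restrict)
    also have "\<dots> \<ge> (\<Sum>i<j. sing_val j M * (cmod (c $ i))\<^sup>2)"
      using s_ge by (intro sum_mono mult_right_mono) auto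
    finally show "sing_val j M * re_inner c c \<le> re_inner (M *\<^sub>v (Y *\<^sub>v c)) (Z *\<^sub>v c)"
      using c by (simp add: re_inner_self_sum sum_distrib_left)
  qed
qed

section \<open>Operator norm and trace bounds\<close>

lemma re_inner_mult_le_sing_val_1:
  assumes M: "M \<in> carrier_mat m n" and n: "1 \<le> n" and x: "x \<in> carrier_vec n"
  shows "re_inner (M *\<^sub>v x) (M *\<^sub>v x) \<le> (sing_val 1 M)\<^sup>2 * re_inner x x"
proof -
  obtain V where V: "V \<in> carrier_mat n n" and VV: "mat_adjoint V * V = 1\<^sub>m n"
    and VV': "V * mat_adjoint V = 1\<^sub>m n"
    and inner: "\<And>c d. c \<in> carrier_vec n \<Longrightarrow> d \<in> carrier_vec n \<Longrightarrow>
      re_inner (M *\<^sub>v (V *\<^sub>v c)) (M *\<^sub>v (V *\<^sub>v d)) =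
        (\<Sum>i<n. (sing_val (Suc i) M)\<^sup>2 * Re (c $ i * cnj (d $ i)))"
    by (rule singular_basis[OF M]) (rule that)
  define d where "d = mat_adjoint V *\<^sub>v x"
  have d: "d \<in> carrier_vec n" using V x by (simp add: d_def)
  have xd: "x = V *\<^sub>v d"
    using V x unfolding d_def by (subst assoc_mult_mat_vec[symmetric, of _ n n _ n]) (auto simp: VV')
  have "re_inner (M *\<^sub>v x) (M *\<^sub>v x) = (\<Sum>i<n. (sing_val (Suc i) M)\<^sup>2 * (cmod (d $ i))\<^sup>2)"
    unfolding xd inner[OF d d] by (simp only: Re_mult_cnj_self)
  also have "\<dots> \<le> (\<Sum>i<n. (sing_val 1 M)\<^sup>2 * (cmod (d $ i))\<^sup>2)"
    using sing_val_antimono[OF M, of 1] sing_val_nonneg[OF M]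
    by (intro sum_mono mult_right_mono power_mono) auto
  also have "\<dots> = (sing_val 1 M)\<^sup>2 * re_inner d d"
    using d by (simp add: re_inner_self_sum[of _ n] sum_distrib_left)
  also have "re_inner d d = re_inner x x"
    unfolding xd by (rule isometry_re_inner[OF V VV d d, symmetric])
  finally show ?thesis .
qed

text \<open>The squared norm of the image \<open>?x\<close> of \<open>y\<close> is the inner product
  of \<open>M ?x\<close> with \<open>y\<close>; Cauchy-Schwarz and the bound for \<open>M\<close>
  leave one factor to cancel.\<close>

lemma re_inner_adjoint_mult_le_sing_val_1:
  assumes M: "M \<in> carrier_mat m n" and n: "1 \<le> n" and y: "y \<in> carrier_vec m"
  shows "re_inner (mat_adjoint M *\<^sub>v y) (mat_adjoint M *\<^sub>v y) \<le> (sing_val 1 M)\<^sup>2 * re_inner y y"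
proof -
  let ?x = "mat_adjoint M *\<^sub>v y"
  have x: "?x \<in> carrier_vec n" by (rule mult_mat_vec_carrier[OF mat_adjoint_carrier[OF M] y])
  have Mx: "M *\<^sub>v ?x \<in> carrier_vec m" using M x by auto
  have "(re_inner ?x ?x)\<^sup>2 = (re_inner (M *\<^sub>v ?x) y)\<^sup>2"
    using re_inner_adjoint[OF M x y] by simp
  also have "\<dots> \<le> re_inner (M *\<^sub>v ?x) (M *\<^sub>v ?x) * re_inner y y"
    by (rule re_inner_cauchy_schwarz[OF Mx y])
  also have "\<dots> \<le> ((sing_val 1 M)\<^sup>2 * re_inner ?x ?x) * re_inner y y"
    by (intro mult_right_mono re_inner_mult_le_sing_val_1[OF M n x]) simp
  finally have "re_inner ?x ?x * re_inner ?x ?x \<le> re_inner ?x ?x * ((sing_val 1 M)\<^sup>2 * re_inner y y)"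
    by (simp add: power2_eq_square mult_ac)
  then show ?thesis
    by (cases "re_inner ?x ?x = 0") (use re_inner_ge_0[of ?x] in \<open>auto simp: mult_le_cancel_left\<close>)
qed

lemma psd_diag_nonneg:
  assumes "psd S" "S \<in> carrier_mat n n" "i < n"
  shows "0 \<le> Re (S $$ (i, i))"
proof -
  have "re_inner (S *\<^sub>v unit_vec n i) (unit_vec n i) = Re (S $$ (i, i))"
  proof -
    have "conjugate (unit_vec n i :: complex vec) = unit_vec n i"
      by (rule eq_vecI) (auto simp: unit_vec_def)
    then show ?thesis using assms(2,3) by (simp add: re_inner_def)
  qed
  then show ?thesis using psd_re_inner[OF assms(1,2), of "unit_vec n i"] by simp
qed

lemma psd_trace_nonneg:
  assumes "psd S" "S \<in> carrier_mat n n"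
  shows "0 \<le> Re (mat_trace S)"
  using psd_diag_nonneg[OF assms] assms(2) by (auto simp: mat_trace_def intro!: sum_nonneg)

text \<open>No eigenvalues are used: Cauchy-Schwarz for the form of \<open>S\<close> controls every
  summand of the form at \<open>x\<close> by the root of a diagonal entry, and the ordinary
  inequality sums these bounds up to the trace.\<close>

lemma psd_re_inner_le_trace:
  assumes psd: "psd S" and S: "S \<in> carrier_mat n n" and x: "x \<in> carrier_vec n"
  shows "re_inner (S *\<^sub>v x) x \<le> Re (mat_trace S) * re_inner x x"
proof -
  define f where "f = re_inner (S *\<^sub>v x) x"
  define d where "d i = sqrt (Re (S $$ (i, i)))" for i
  have f: "0 \<le> f" unfolding f_def by (rule psd_re_inner[OF psd S x])
  have entry: "Re ((S *\<^sub>v x) $ i * cnj (x $ i)) \<le> sqrt f * (cmod (x $ i) * d i)" if i: "i < n" for i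
  proof -
    \<comment> \<open>The part of \<open>x\<close> along axis \<open>i\<close>; pairing with it
      isolates one summand of the form.\<close>
    let ?w = "x $ i \<cdot>\<^sub>v unit_vec n i"
    have w: "?w \<in> carrier_vec n" by simp
    have conj: "conjugate (unit_vec n i :: complex vec) = unit_vec n i"
      by (rule eq_vecI) (auto simp: unit_vec_def)
    have 1: "re_inner (S *\<^sub>v x) ?w = Re ((S *\<^sub>v x) $ i * cnj (x $ i))"
      using S x i by (simp add: re_inner_def conjugate_smult_vec conj mult.commute)
    have 2: "re_inner (S *\<^sub>v ?w) ?w = (cmod (x $ i))\<^sup>2 * (d i)\<^sup>2"
    proof -
      have "S *\<^sub>v ?w = x $ i \<cdot>\<^sub>v (S *\<^sub>v unit_vec n i)"
        using S by (intro mult_mat_vec) auto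
      then have "re_inner (S *\<^sub>v ?w) ?w = Re (x $ i * (S $$ (i, i) * cnj (x $ i)))"
        using S i by (simp add: re_inner_def conjugate_smult_vec conj mult_ac)
      also have "x $ i * (S $$ (i, i) * cnj (x $ i)) = complex_of_real ((cmod (x $ i))\<^sup>2) * S $$ (i, i)"
        using complex_norm_square[of "x $ i"] by (simp add: mult_ac)
      finally show ?thesis using psd_diag_nonneg[OF psd S i] by (simp add: d_def flip: of_real_power)
    qed
    have "(Re ((S *\<^sub>v x) $ i * cnj (x $ i)))\<^sup>2 \<le> (sqrt f * (cmod (x $ i) * d i))\<^sup>2"
      using psd_cauchy_schwarz[OF psd S x w] f unfolding 1 2 f_def[symmetric]
      by (simp add: power_mult_distrib)
    moreover have "0 \<le> sqrt f * (cmod (x $ i) * d i)"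
      using f psd_diag_nonneg[OF psd S i] by (simp add: d_def)
    ultimately show ?thesis by (rule power2_le_imp_le)
  qed
  have "f = (\<Sum>i<n. Re ((S *\<^sub>v x) $ i * cnj (x $ i)))"
    unfolding f_def using S x by (intro re_inner_sum) auto
  also have "\<dots> \<le> (\<Sum>i<n. sqrt f * (cmod (x $ i) * d i))"
    using entry by (intro sum_mono) auto
  also have "\<dots> = sqrt f * (\<Sum>i<n. cmod (x $ i) * d i)"
    by (simp add: sum_distrib_left)
  finally have le: "sqrt f * sqrt f \<le> sqrt f * (\<Sum>i<n. cmod (x $ i) * d i)" using f by simp
  have nonneg: "0 \<le> (\<Sum>i<n. cmod (x $ i) * d i)"
    using psd_diag_nonneg[OF psd S] by (intro sum_nonneg) (auto simp: d_def)
  \<comment> \<open>One factor \<open>sqrt f\<close> is cancelled; for \<open>f = 0\<close> the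
    right side is nonnegative anyway.\<close>
  have "sqrt f \<le> (\<Sum>i<n. cmod (x $ i) * d i)"
  proof (cases "f = 0")
    case False
    then have "0 < sqrt f" using f by simp
    then show ?thesis using le by (metis mult_le_cancel_left_pos)
  qed (use nonneg in simp)
  then have "(sqrt f)\<^sup>2 \<le> (\<Sum>i<n. cmod (x $ i) * d i)\<^sup>2"
    using f by (intro power_mono) auto
  \<comment> \<open>Ordinary Cauchy-Schwarz for the vectors of moduli \<open>cmod (x $ i)\<close>
    and of roots \<open>d i\<close>.\<close>
  also have "\<dots> \<le> (\<Sum>i<n. (cmod (x $ i))\<^sup>2) * (\<Sum>i<n. (d i)\<^sup>2)"
    using re_inner_cauchy_schwarz[of "vec n (\<lambda>i. complex_of_real (cmod (x $ i)))" n
        "vec n (\<lambda>i. complex_of_real (d i))"]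
    by (simp add: re_inner_sum[of _ n] power2_eq_square)
  also have "(\<Sum>i<n. (d i)\<^sup>2) = Re (mat_trace S)"
    using S psd_diag_nonneg[OF psd S] by (simp add: mat_trace_def d_def)
  finally show ?thesis using f x by (simp add: f_def re_inner_self_sum mult.commute)
qed

section \<open>Bounds from quadratic forms and under scalar shifts\<close>

text \<open>For \<open>s > 0\<close>, Cauchy-Schwarz turns a lower bound on the form into the lower
  bound on the norm of \<open>M y\<close> asked for by \<open>sing_val_ge\<close>; for other
  \<open>s\<close>, nonnegativity of singular values suffices.\<close>

lemma sing_val_ge_re_inner:
  assumes M: "M \<in> carrier_mat m m" and j: "1 \<le> j" "j \<le> m" and Y: "Y \<in> carrier_mat m j"
    and inj: "\<And>c. c \<in> carrier_vec j \<Longrightarrow> c \<noteq> 0\<^sub>v j \<Longrightarrow> Y *\<^sub>v c \<noteq> 0\<^sub>v m"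
    and ge: "\<And>c. c \<in> carrier_vec j \<Longrightarrow>
      s * re_inner (Y *\<^sub>v c) (Y *\<^sub>v c) \<le> re_inner (M *\<^sub>v (Y *\<^sub>v c)) (Y *\<^sub>v c)"
  shows "s \<le> sing_val j M"
proof (cases "s \<le> 0")
  case True
  then show ?thesis using sing_val_nonneg[OF M j] by simp
next
  case False
  show ?thesis
  proof (rule sing_val_ge[OF M j Y inj])
    fix c :: "complex vec" assume c: "c \<in> carrier_vec j"
    define y where "y = Y *\<^sub>v c"
    have y: "y \<in> carrier_vec m" and My: "M *\<^sub>v y \<in> carrier_vec m" using Y M c by (auto simp: y_def)
    have "(s * re_inner y y)\<^sup>2 \<le> (re_inner (M *\<^sub>v y) y)\<^sup>2"
      using ge[OF c] False by (intro power_mono) (auto simp: y_def)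
    also have "\<dots> \<le> re_inner (M *\<^sub>v y) (M *\<^sub>v y) * re_inner y y"
      by (rule re_inner_cauchy_schwarz[OF My y])
    finally have "re_inner y y * (s\<^sup>2 * re_inner y y) \<le> re_inner y y * re_inner (M *\<^sub>v y) (M *\<^sub>v y)"
      by (simp add: power2_eq_square mult_ac)
    then show "s\<^sup>2 * re_inner (Y *\<^sub>v c) (Y *\<^sub>v c) \<le> re_inner (M *\<^sub>v (Y *\<^sub>v c)) (M *\<^sub>v (Y *\<^sub>v c))"
      unfolding y_def[symmetric]
      by (cases "re_inner y y = 0") (use re_inner_ge_0[of y] in \<open>auto simp: mult_le_cancel_left\<close>)
  qed
qed

lemma smult_one_mult_vec:
  fixes v :: "complex vec"
  shows "v \<in> carrier_vec m \<Longrightarrow> (k \<cdot>\<^sub>m 1\<^sub>m m) *\<^sub>v v = k \<cdot>\<^sub>v v"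
  by (rule eq_vecI) auto

text \<open>A Weyl-type perturbation bound. On the frame of the shifted matrix the scalar part
  contributes at most \<open>cmod k\<close> times the squared norm, and Cauchy-Schwarz for the rest
  yields a \<open>j\<close>-dimensional space on which \<open>M\<close> stretches by at least the
  difference. The case split makes that difference positive, so squaring is monotone.\<close>

lemma sing_val_add_scalar_le:
  assumes M: "M \<in> carrier_mat m m" and j: "1 \<le> j" "j \<le> m"
  shows "sing_val j (k \<cdot>\<^sub>m 1\<^sub>m m + M) \<le> sing_val j M + cmod k"
proof (cases "sing_val j (k \<cdot>\<^sub>m 1\<^sub>m m + M) \<le> cmod k")
  case True
  then show ?thesis using sing_val_nonneg[OF M j] by simp
next
  case False
  let ?P = "k \<cdot>\<^sub>m 1\<^sub>m m + M"
  have P: "?P \<in> carrier_mat m m" using M by simp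
  have "0 < sing_val j ?P" using False norm_ge_zero[of k] by linarith
  then obtain Y Z where
    Y: "Y \<in> carrier_mat m j" and Z: "Z \<in> carrier_mat m j"
    and Yc: "\<And>c. c \<in> carrier_vec j \<Longrightarrow> re_inner (Y *\<^sub>v c) (Y *\<^sub>v c) = re_inner c c"
    and Zc: "\<And>c. c \<in> carrier_vec j \<Longrightarrow> re_inner (Z *\<^sub>v c) (Z *\<^sub>v c) = re_inner c c"
    and ge: "\<And>c. c \<in> carrier_vec j \<Longrightarrow> sing_val j ?P * re_inner c c \<le> re_inner (?P *\<^sub>v (Y *\<^sub>v c)) (Z *\<^sub>v c)"
    by (rule sing_val_frame[OF P j]) (rule that)
  have "sing_val j ?P - cmod k \<le> sing_val j M"
  proof (rule sing_val_ge[OF M j Y])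
    fix c :: "complex vec" assume c: "c \<in> carrier_vec j"
    define y z where "y = Y *\<^sub>v c" and "z = Z *\<^sub>v c"
    have y: "y \<in> carrier_vec m" and z: "z \<in> carrier_vec m" using Y Z c by (auto simp: y_def z_def)
    have My: "M *\<^sub>v y \<in> carrier_vec m" using M y by simp
    have nz: "re_inner z z = re_inner y y" using Yc[OF c] Zc[OF c] by (simp add: y_def z_def)
    have "(re_inner (k \<cdot>\<^sub>v y) z)\<^sup>2 \<le> (cmod k * re_inner y y)\<^sup>2"
      using re_inner_cauchy_schwarz[of "k \<cdot>\<^sub>v y" m z] y z
      by (simp add: re_inner_smult_self[of _ m] nz power2_eq_square mult_ac)
    then have ky: "re_inner (k \<cdot>\<^sub>v y) z \<le> cmod k * re_inner y y"
      by (rule power2_le_imp_le) simp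
    have "?P *\<^sub>v y = k \<cdot>\<^sub>v y + M *\<^sub>v y"
      using M y by (simp add: add_mult_distrib_mat_vec[of _ m m] smult_one_mult_vec)
    then have "sing_val j ?P * re_inner y y \<le> re_inner (k \<cdot>\<^sub>v y) z + re_inner (M *\<^sub>v y) z"
      using ge[OF c] Yc[OF c] y z My by (simp add: y_def[symmetric] z_def[symmetric] re_inner_add_left[of _ m])
    then have "(sing_val j ?P - cmod k) * re_inner y y \<le> re_inner (M *\<^sub>v y) z"
      using ky by (simp add: algebra_simps)
    then have "((sing_val j ?P - cmod k) * re_inner y y)\<^sup>2 \<le> (re_inner (M *\<^sub>v y) z)\<^sup>2"
      using False by (intro power_mono) auto
    also have "\<dots> \<le> re_inner (M *\<^sub>v y) (M *\<^sub>v y) * re_inner y y"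
      using re_inner_cauchy_schwarz[OF My z] by (simp add: nz)
    finally have "re_inner y y * ((sing_val j ?P - cmod k)\<^sup>2 * re_inner y y) \<le>
        re_inner y y * re_inner (M *\<^sub>v y) (M *\<^sub>v y)"
      by (simp add: power2_eq_square mult_ac)
    then show "(sing_val j ?P - cmod k)\<^sup>2 * re_inner (Y *\<^sub>v c) (Y *\<^sub>v c) \<le>
        re_inner (M *\<^sub>v (Y *\<^sub>v c)) (M *\<^sub>v (Y *\<^sub>v c))"
      unfolding y_def[symmetric]
      by (cases "re_inner y y = 0") (use re_inner_ge_0[of y] in \<open>auto simp: mult_le_cancel_left\<close>)
    assume "c \<noteq> 0\<^sub>v j"
    then show "Y *\<^sub>v c \<noteq> 0\<^sub>v m"
      using Yc[OF c] re_inner_pos[OF c] by (auto simp: re_inner_def)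
  qed
  then show ?thesis by simp
qed

subsection \<open>Compressions of a positive semidefinite block matrix\<close>

text \<open>For \<open>cmod w = 1\<close> this is the compression of the block matrix to the vectors
  \<open>(x, w x)\<close>. The matrix \<open>S\<close> of the overview is the case
  \<open>- w\<close>; the expanded form makes the trace and the effect of a sign change
  visible.\<close>

definition block_compression :: "complex \<Rightarrow> complex mat \<Rightarrow> complex mat \<Rightarrow> complex mat \<Rightarrow> complex mat" where
  "block_compression w A X C = (A + C) + (w \<cdot>\<^sub>m X + cnj w \<cdot>\<^sub>m mat_adjoint X)"

lemma mat_trace_add:
  "A \<in> carrier_mat n n \<Longrightarrow> B \<in> carrier_mat n n \<Longrightarrow> mat_trace (A + B) = mat_trace A + mat_trace B"
  by (auto simp: mat_trace_def sum.distrib)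

lemma mat_trace_smult:
  "A \<in> carrier_mat n n \<Longrightarrow> mat_trace (k \<cdot>\<^sub>m A) = k * mat_trace (A :: complex mat)"
  by (auto simp: mat_trace_def sum_distrib_left)

lemma mat_trace_adjoint:
  "A \<in> carrier_mat n n \<Longrightarrow> mat_trace (mat_adjoint A) = cnj (mat_trace A)"
  by (auto simp: mat_trace_def)

lemma smult_mat_mult_vec:
  fixes A :: "complex mat"
  shows "A \<in> carrier_mat m n \<Longrightarrow> v \<in> carrier_vec n \<Longrightarrow> (k \<cdot>\<^sub>m A) *\<^sub>v v = k \<cdot>\<^sub>v (A *\<^sub>v v)"
  by (rule eq_vecI) (auto simp: scalar_prod_def sum_distrib_left mult_ac)

context
  fixes n :: nat and A X C :: "complex mat"
  assumes A: "A \<in> carrier_mat n n" and X: "X \<in> carrier_mat n n" and C: "C \<in> carrier_mat n n"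
    and psd: "psd (four_block_mat A X (mat_adjoint X) C)"
begin

lemma block_carrier: "four_block_mat A X (mat_adjoint X) C \<in> carrier_mat (n + n) (n + n)"
  using A C by simp

lemma block_re_inner:
  assumes "p \<in> carrier_vec n" "q \<in> carrier_vec n" "x \<in> carrier_vec n" "z \<in> carrier_vec n"
  shows "re_inner (four_block_mat A X (mat_adjoint X) C *\<^sub>v (p @\<^sub>v q)) (x @\<^sub>v z) =
    re_inner (A *\<^sub>v p + X *\<^sub>v q) x + re_inner (mat_adjoint X *\<^sub>v p + C *\<^sub>v q) z"
  using A X C assms
  by (subst four_block_mat_mult_vec[of _ n n _ n _ n]) (auto intro!: re_inner_append[of _ n _ _ n])

lemma block_compression_carrier: "block_compression w A X C \<in> carrier_mat n n"
  using A X C by (auto simp: block_compression_def)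

lemma re_inner_block_compression:
  assumes x: "x \<in> carrier_vec n"
  shows "re_inner (block_compression w A X C *\<^sub>v x) x = re_inner ((A + C) *\<^sub>v x) x +
    (re_inner (w \<cdot>\<^sub>v (X *\<^sub>v x)) x + re_inner (cnj w \<cdot>\<^sub>v (mat_adjoint X *\<^sub>v x)) x)"
proof -
  note X' = mat_adjoint_carrier[OF X]
  have AC: "A + C \<in> carrier_mat n n" using A C by simp
  have [simp]: "X *\<^sub>v x \<in> carrier_vec n" "mat_adjoint X *\<^sub>v x \<in> carrier_vec n"
    "(A + C) *\<^sub>v x \<in> carrier_vec n"
    using X x AC by (auto intro!: mult_mat_vec_carrier[of _ n n])
  have "block_compression w A X C *\<^sub>v x =
      (A + C) *\<^sub>v x + (w \<cdot>\<^sub>m X + cnj w \<cdot>\<^sub>m mat_adjoint X) *\<^sub>v x"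
    unfolding block_compression_def by (rule add_mult_distrib_mat_vec) (use AC X X' x in auto)
  also have "(w \<cdot>\<^sub>m X + cnj w \<cdot>\<^sub>m mat_adjoint X) *\<^sub>v x =
      w \<cdot>\<^sub>v (X *\<^sub>v x) + cnj w \<cdot>\<^sub>v (mat_adjoint X *\<^sub>v x)"
    using X X' x by (simp add: add_mult_distrib_mat_vec[of _ n n] smult_mat_mult_vec[of _ n n])
  finally show ?thesis using x by (simp add: re_inner_add_left[of _ n])
qed

text \<open>The modulus of \<open>w\<close> enters through the lower right block, which contributes
  with the factor \<open>w * cnj w = 1\<close>; the off-diagonal blocks keep a phase.\<close>

lemma block_compression_re_inner:
  assumes w: "cmod w = 1" and x: "x \<in> carrier_vec n"
  shows "re_inner (block_compression w A X C *\<^sub>v x) x =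
    re_inner (four_block_mat A X (mat_adjoint X) C *\<^sub>v (x @\<^sub>v w \<cdot>\<^sub>v x)) (x @\<^sub>v w \<cdot>\<^sub>v x)"
proof -
  have Xx: "mat_adjoint X *\<^sub>v x \<in> carrier_vec n" using X by auto
  have "re_inner (w \<cdot>\<^sub>v (C *\<^sub>v x)) (w \<cdot>\<^sub>v x) = re_inner (C *\<^sub>v x) x"
  proof -
    have "cnj w \<cdot>\<^sub>v (w \<cdot>\<^sub>v x) = x"
      using w x complex_norm_square[of w] by (simp add: smult_smult_assoc mult.commute)
    then show ?thesis using C x by (simp add: re_inner_smult_left[of _ n])
  qed
  moreover have "re_inner (mat_adjoint X *\<^sub>v x) (w \<cdot>\<^sub>v x) = re_inner (cnj w \<cdot>\<^sub>v (mat_adjoint X *\<^sub>v x)) x"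
    using Xx x by (simp add: re_inner_smult_left[of _ n])
  ultimately show ?thesis
    using A X C x Xx
    by (simp add: re_inner_block_compression block_re_inner re_inner_add_left[of _ n]
        mult_mat_vec[of _ n n] add_mult_distrib_mat_vec[of _ n n])
qed

lemma block_hermitian: "mat_adjoint A = A" "mat_adjoint C = C"
proof -
  let ?T = "four_block_mat A X (mat_adjoint X) C"
  have T: "four_block_mat (mat_adjoint A) X (mat_adjoint X) (mat_adjoint C) = ?T"
    using psd mat_adjoint_four_block[OF A X mat_adjoint_carrier[OF X] C] by (simp add: psd_def)
  show "mat_adjoint A = A"
  proof (rule eq_matI)
    fix i j assume "i < dim_row A" "j < dim_col A"
    then show "mat_adjoint A $$ (i, j) = A $$ (i, j)"
      using arg_cong[OF T, of "\<lambda>M. M $$ (i, j)"] A C by simp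
  qed (use A in auto)
  show "mat_adjoint C = C"
  proof (rule eq_matI)
    fix i j assume "i < dim_row C" "j < dim_col C"
    then show "mat_adjoint C $$ (i, j) = C $$ (i, j)"
      \<comment> \<open>The shift by \<open>n\<close> selects the lower right block.\<close>
      using arg_cong[OF T, of "\<lambda>M. M $$ (n + i, n + j)"] A C by simp
  qed (use C in auto)
qed

lemma psd_block_compression:
  assumes w: "cmod w = 1"
  shows "psd (block_compression w A X C)"
proof -
  have "mat_adjoint (block_compression w A X C) = block_compression w A X C"
    unfolding block_compression_def
    using A X C block_hermitian mat_adjoint_carrier[OF X]
    by (simp add: mat_adjoint_add[of _ n n] mat_adjoint_smult comm_add_mat[of _ n n])
  moreover have "0 \<le> re_inner (block_compression w A X C *\<^sub>v x) x" if "x \<in> carrier_vec n" for x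
    using psd_re_inner[OF psd block_carrier] that by (simp add: block_compression_re_inner[OF w that])
  ultimately show ?thesis
    using block_compression_carrier[of w] by (auto simp: psd_def re_inner_def)
qed

text \<open>The cross terms are odd in \<open>w\<close> and cancel. For \<open>cmod w = 1\<close>
  the form of \<open>A + C\<close> is thus the mean of two nonnegative forms, so either of them is
  at most twice that form.\<close>

lemma block_compression_sum:
  assumes x: "x \<in> carrier_vec n"
  shows "re_inner (block_compression w A X C *\<^sub>v x) x + re_inner (block_compression (- w) A X C *\<^sub>v x) x =
    2 * re_inner ((A + C) *\<^sub>v x) x"
proof -
  have [simp]: "X *\<^sub>v x \<in> carrier_vec n" "mat_adjoint X *\<^sub>v x \<in> carrier_vec n"
    using X x by auto
  have "re_inner (- z \<cdot>\<^sub>v v) x = - re_inner (z \<cdot>\<^sub>v v) x" if "v \<in> carrier_vec n" for z v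
    using that x by (simp add: re_inner_sum[of _ n] sum_negf sum_subtractf flip: minus_mult_left)
  then show ?thesis using x by (simp add: re_inner_block_compression)
qed

lemma mat_trace_block_compression:
  "Re (mat_trace (block_compression w A X C)) = Re (mat_trace (A + C)) + 2 * Re (w * mat_trace X)"
  using A X C mat_adjoint_carrier[OF X] unfolding block_compression_def
  by (simp add: mat_trace_add[of _ n] mat_trace_smult[of _ n] mat_trace_adjoint[of _ n])

text \<open>The estimate for one pair \<open>u\<close>, \<open>v\<close>. Write
  \<open>y = a + b\<close> and \<open>y' = a - b\<close>. The form at the chosen vector bounds the
  squared norms of \<open>a\<close> and \<open>b\<close> together from below, and the hypothesis
  \<open>trace\<close> keeps \<open>y'\<close> small, so the parallelogram law forces
  \<open>y\<close> to be large. Another use of Cauchy-Schwarz converts that size into a bound for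
  the form of \<open>A + C\<close>.\<close>

lemma block_compression_estimate:
  fixes B :: "complex mat"
  assumes B: "B \<in> carrier_mat m n" and w: "cmod w = 1"
    and u: "u \<in> carrier_vec m" and v: "v \<in> carrier_vec m"
    and q: "0 \<le> q" and mu: "q < \<mu>"
    and trace: "\<And>y. y \<in> carrier_vec m \<Longrightarrow>
      re_inner (block_compression (- w) A X C *\<^sub>v (mat_adjoint B *\<^sub>v y)) (mat_adjoint B *\<^sub>v y)
        \<le> 2 * q * re_inner y y"
    and eq: "re_inner u u = re_inner v v" and pos: "0 < re_inner v v"
    and sigma: "\<mu> * re_inner v v \<le> 2 * re_inner (B * X * mat_adjoint B *\<^sub>v v) u"
  defines "z1 \<equiv> A *\<^sub>v (mat_adjoint B *\<^sub>v u) + X *\<^sub>v (mat_adjoint B *\<^sub>v v)"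
    and "z2 \<equiv> mat_adjoint X *\<^sub>v (mat_adjoint B *\<^sub>v u) + C *\<^sub>v (mat_adjoint B *\<^sub>v v)"
  defines "y \<equiv> B *\<^sub>v z1 + cnj w \<cdot>\<^sub>v (B *\<^sub>v z2)"
  shows "0 < re_inner y y"
    and "(\<mu> - q) * re_inner y y \<le> re_inner ((A + C) *\<^sub>v (mat_adjoint B *\<^sub>v y)) (mat_adjoint B *\<^sub>v y)"
proof -
  let ?T = "four_block_mat A X (mat_adjoint X) C"
  note T = block_carrier
  define p r a b where "p = mat_adjoint B *\<^sub>v u" and "r = mat_adjoint B *\<^sub>v v"
    and "a = B *\<^sub>v z1" and "b = cnj w \<cdot>\<^sub>v (B *\<^sub>v z2)"
  define y' where "y' = a + (- 1) \<cdot>\<^sub>v b"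
  define x x' where "x = mat_adjoint B *\<^sub>v y" and "x' = mat_adjoint B *\<^sub>v y'"
  define \<tau> where "\<tau> = re_inner (?T *\<^sub>v (p @\<^sub>v r)) (p @\<^sub>v r)"
  have [simp]: "p \<in> carrier_vec n" "r \<in> carrier_vec n" "x \<in> carrier_vec n" "x' \<in> carrier_vec n"
    using B by (auto simp: p_def r_def x_def x'_def)
  have [simp]: "A *\<^sub>v p \<in> carrier_vec n" "X *\<^sub>v r \<in> carrier_vec n" "mat_adjoint X *\<^sub>v p \<in> carrier_vec n" "C *\<^sub>v r \<in> carrier_vec n"
    using A X C by auto
  have z1: "z1 = A *\<^sub>v p + X *\<^sub>v r" and z2: "z2 = mat_adjoint X *\<^sub>v p + C *\<^sub>v r"
    by (simp_all add: z1_def z2_def p_def r_def)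
  have [simp]: "z1 \<in> carrier_vec n" "z2 \<in> carrier_vec n" by (simp_all add: z1 z2)
  have [simp]: "a \<in> carrier_vec m" "b \<in> carrier_vec m" "B *\<^sub>v z2 \<in> carrier_vec m"
    using B by (auto simp: a_def b_def)
  have y: "y = a + b" by (simp add: y_def a_def b_def)
  have [simp]: "y \<in> carrier_vec m" "y' \<in> carrier_vec m" by (simp_all add: y y'_def)
  have T_form: "re_inner (?T *\<^sub>v (p @\<^sub>v r)) (s @\<^sub>v t) = re_inner z1 s + re_inner z2 t"
    if "s \<in> carrier_vec n" "t \<in> carrier_vec n" for s t
    using that by (simp add: block_re_inner z1 z2)
  have B_adj: "re_inner z (mat_adjoint B *\<^sub>v t) = re_inner (B *\<^sub>v z) t"
    if "z \<in> carrier_vec n" "t \<in> carrier_vec m" for z t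
    using re_inner_adjoint[OF B that] by simp

  have w2: "w * cnj w = 1" using w complex_norm_square[of w] by simp
  have wb: "w \<cdot>\<^sub>v b = B *\<^sub>v z2" by (simp add: b_def smult_smult_assoc w2)
  have nb: "re_inner (B *\<^sub>v z2) (B *\<^sub>v z2) = re_inner b b"
    using w by (simp add: b_def re_inner_smult_self[of _ m])

  \<comment> \<open>Positivity at \<open>(p, - r)\<close> bounds the diagonal terms from below by
    the cross terms, so \<open>\<tau>\<close> is at least four times
    \<open>re_inner (X *\<^sub>v r) p\<close>.\<close>
  have tau_ge: "2 * \<mu> * re_inner v v \<le> \<tau>"
  proof -
    have "0 \<le> re_inner (?T *\<^sub>v (p @\<^sub>v (- 1) \<cdot>\<^sub>v r)) (p @\<^sub>v (- 1) \<cdot>\<^sub>v r)"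
      by (rule psd_re_inner[OF psd T]) simp
    moreover have sym: "re_inner (mat_adjoint X *\<^sub>v p) r = re_inner (X *\<^sub>v r) p"
      using re_inner_adjoint[OF X, of r p] re_inner_commute[of "mat_adjoint X *\<^sub>v p" n r] by simp
    have neg: "re_inner ((- 1) \<cdot>\<^sub>v s) t = - re_inner s t" "re_inner s ((- 1) \<cdot>\<^sub>v t) = - re_inner s t"
      if "s \<in> carrier_vec n" "t \<in> carrier_vec n" for s t
      using re_inner_of_real_left[OF that, of "- 1"] re_inner_of_real_right[OF that(2,1), of "- 1"] by simp_all
    have "re_inner (?T *\<^sub>v (p @\<^sub>v (- 1) \<cdot>\<^sub>v r)) (p @\<^sub>v (- 1) \<cdot>\<^sub>v r) =
        re_inner (A *\<^sub>v p) p + re_inner (C *\<^sub>v r) r - 2 * re_inner (X *\<^sub>v r) p"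
      using A X C by (simp add: block_re_inner re_inner_add_left[of _ n] neg sym mult_mat_vec[of _ n n])
    moreover have "\<tau> = re_inner (A *\<^sub>v p) p + re_inner (C *\<^sub>v r) r + 2 * re_inner (X *\<^sub>v r) p"
      by (simp add: \<tau>_def block_re_inner re_inner_add_left[of _ n] sym)
    moreover have "re_inner (B * X * mat_adjoint B *\<^sub>v v) u = re_inner (X *\<^sub>v r) p"
      using B X u v mat_adjoint_carrier[OF B]
      by (simp add: p_def B_adj r_def assoc_mult_mat_vec[of _ m n _ m] assoc_mult_mat_vec[of _ m n _ n])
    ultimately show ?thesis using sigma by linarith
  qed
  have mu_pos: "0 < \<mu>" using q mu by simp
  have tau_pos: "0 < \<tau>" using tau_ge mu_pos pos by (smt (verit) mult_pos_pos)

  \<comment> \<open>\<open>\<tau>\<close> is also the inner product of \<open>(a, B z2)\<close> with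
    \<open>(u, v)\<close>, whose squared norm is twice that of \<open>v\<close>;
    \<open>tau_ge\<close> trades the latter for \<open>\<tau>\<close>, and one factor
    cancels.\<close>
  have norm_ge: "\<mu> * \<tau> \<le> re_inner a a + re_inner b b"
  proof -
    have "\<tau> = re_inner z1 p + re_inner z2 r" unfolding \<tau>_def by (rule T_form) simp_all
    also have "\<dots> = re_inner a u + re_inner (B *\<^sub>v z2) v"
      using u v by (simp add: a_def p_def r_def B_adj)
    also have "\<dots> = re_inner (a @\<^sub>v B *\<^sub>v z2) (u @\<^sub>v v)"
      using u v by (simp add: re_inner_append[of _ m _ _ m])
    finally have "\<tau>\<^sup>2 \<le> re_inner (a @\<^sub>v B *\<^sub>v z2) (a @\<^sub>v B *\<^sub>v z2) * re_inner (u @\<^sub>v v) (u @\<^sub>v v)"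
      using re_inner_cauchy_schwarz[of "a @\<^sub>v B *\<^sub>v z2" "m + m" "u @\<^sub>v v"] u v by simp
    also have "\<dots> = (re_inner a a + re_inner b b) * (2 * re_inner v v)"
      using u v by (simp add: re_inner_append[of _ m _ _ m] eq nb)
    finally have "\<mu> * \<tau>\<^sup>2 \<le> (re_inner a a + re_inner b b) * (2 * \<mu> * re_inner v v)"
      using mu_pos by (simp add: mult_ac)
    also have "\<dots> \<le> (re_inner a a + re_inner b b) * \<tau>"
      using tau_ge by (intro mult_left_mono) auto
    finally have "(\<mu> * \<tau>) * \<tau> \<le> (re_inner a a + re_inner b b) * \<tau>"
      by (simp add: power2_eq_square mult_ac)
    then show ?thesis using tau_pos by simp
  qed
  have parallelogram: "re_inner y y + re_inner y' y' = 2 * (re_inner a a + re_inner b b)"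
    using re_inner_of_real_left[of b m _ "- 1"] re_inner_of_real_right[of b m _ "- 1"]
    by (simp add: y y'_def re_inner_add_left[of _ m] re_inner_add_right[of _ m])

  \<comment> \<open>The phase in \<open>b\<close> is chosen for this: pairing with
    \<open>(?s, e w ?s)\<close> gives exactly the squared norm of \<open>t = a + e b\<close>. The
    sign 1 leads to \<open>y\<close> and the compression at \<open>w\<close>, the sign -1 to
    \<open>y'\<close> and the one at \<open>- w\<close>.\<close>
  have cs: "(re_inner t t)\<^sup>2 \<le> \<tau> * re_inner (block_compression (e * w) A X C *\<^sub>v (mat_adjoint B *\<^sub>v t)) (mat_adjoint B *\<^sub>v t)"
    if t: "t = a + e \<cdot>\<^sub>v b" and e: "e = 1 \<or> e = -1" for t e
  proof -
    let ?s = "mat_adjoint B *\<^sub>v t"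
    have [simp]: "t \<in> carrier_vec m" "?s \<in> carrier_vec n" using B by (auto simp: t)
    have ew: "cmod (e * w) = 1" using w e by auto
    have "re_inner (?T *\<^sub>v (p @\<^sub>v r)) (?s @\<^sub>v (e * w) \<cdot>\<^sub>v ?s) = re_inner a t + re_inner z2 ((e * w) \<cdot>\<^sub>v ?s)"
      by (simp add: T_form B_adj a_def)
    also have "re_inner z2 ((e * w) \<cdot>\<^sub>v ?s) = re_inner (cnj (e * w) \<cdot>\<^sub>v z2) ?s"
      by (subst re_inner_smult_left[of _ n]) simp_all
    also have "re_inner (cnj (e * w) \<cdot>\<^sub>v z2) ?s = re_inner (e \<cdot>\<^sub>v b) t"
      using B e by (auto simp: B_adj b_def mult_mat_vec[of _ m n] smult_smult_assoc)
    also have "re_inner a t + re_inner (e \<cdot>\<^sub>v b) t = re_inner t t"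
      unfolding t by (subst re_inner_add_left[of a m "e \<cdot>\<^sub>v b", symmetric]) auto
    finally show ?thesis
      using psd_cauchy_schwarz[OF psd T, of "p @\<^sub>v r" "?s @\<^sub>v (e * w) \<cdot>\<^sub>v ?s"]
      by (simp add: \<tau>_def block_compression_re_inner[OF ew])
  qed

  have "(re_inner y' y')\<^sup>2 \<le> \<tau> * (2 * q * re_inner y' y')"
  proof -
    have "(re_inner y' y')\<^sup>2 \<le> \<tau> * re_inner (block_compression (- w) A X C *\<^sub>v x') x'"
      using cs[of y' "- 1"] by (simp add: y'_def x'_def)
    also have "\<dots> \<le> \<tau> * (2 * q * re_inner y' y')"
      using trace[of y'] tau_pos by (intro mult_left_mono) (auto simp: x'_def)
    finally show ?thesis .
  qed
  then have "re_inner y' y' * re_inner y' y' \<le> re_inner y' y' * (2 * q * \<tau>)"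
    by (simp add: power2_eq_square mult_ac)
  then have "re_inner y' y' \<le> 2 * q * \<tau>"
    using re_inner_ge_0[of y'] q tau_pos by (cases "re_inner y' y' = 0") (auto simp: mult_le_cancel_left)
  \<comment> \<open>The squared norms of \<open>y\<close> and \<open>y'\<close> add up to at least
    \<open>2 * \<mu> * \<tau>\<close>, of which \<open>y'\<close> takes at most
    \<open>2 * q * \<tau>\<close>.\<close>
  with parallelogram norm_ge have y_ge: "2 * (\<mu> - q) * \<tau> \<le> re_inner y y"
    by (simp add: algebra_simps)
  moreover have "0 < (\<mu> - q) * \<tau>" using mu tau_pos by simp
  ultimately show y_pos: "0 < re_inner y y" by linarith

  let ?H = "re_inner ((A + C) *\<^sub>v x) x"
  have "(re_inner y y)\<^sup>2 \<le> \<tau> * re_inner (block_compression w A X C *\<^sub>v x) x"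
    using cs[of y 1] by (simp add: y x_def)
  \<comment> \<open>The compression at \<open>- w\<close> is nonnegative, so the one at
    \<open>w\<close> is at most the sum of both.\<close>
  also have "\<dots> \<le> \<tau> * (2 * ?H)"
    using block_compression_sum[of x w] tau_pos
      psd_re_inner[OF psd_block_compression[of "- w"] block_compression_carrier, of x] w
    by (intro mult_left_mono) auto
  finally have le: "(re_inner y y)\<^sup>2 \<le> 2 * \<tau> * ?H" by simp
  then have "0 \<le> ?H" using tau_pos by (smt (verit) mult_pos_neg zero_le_power2)
  have "((\<mu> - q) * re_inner y y) * re_inner y y = (\<mu> - q) * (re_inner y y)\<^sup>2"
    by (simp add: power2_eq_square)
  also have "\<dots> \<le> (\<mu> - q) * (2 * \<tau> * ?H)"
    using le mu by (intro mult_left_mono) auto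
  also have "\<dots> = (2 * (\<mu> - q) * \<tau>) * ?H" by simp
  also have "\<dots> \<le> re_inner y y * ?H"
    using y_ge \<open>0 \<le> ?H\<close> by (rule mult_right_mono)
  finally have "((\<mu> - q) * re_inner y y) * re_inner y y \<le> ?H * re_inner y y" by (simp add: mult_ac)
  then show "(\<mu> - q) * re_inner y y \<le> re_inner ((A + C) *\<^sub>v (mat_adjoint B *\<^sub>v y)) (mat_adjoint B *\<^sub>v y)"
    using y_pos by (simp add: x_def)
qed

end

section \<open>The form and the singular values of \<open>Phi_plus\<close>\<close>

lemma re_inner_Phi_plus:
  assumes B: "B \<in> carrier_mat m n" and H: "H \<in> carrier_mat n n" and y: "y \<in> carrier_vec m"
  shows "re_inner (Phi_plus t B H *\<^sub>v y) y =
    t * Re (mat_trace H) * re_inner y y + re_inner (H *\<^sub>v (mat_adjoint B *\<^sub>v y)) (mat_adjoint B *\<^sub>v y)"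
proof -
  note B' = mat_adjoint_carrier[OF B]
  have x: "mat_adjoint B *\<^sub>v y \<in> carrier_vec n" using B by auto
  have Hx: "H *\<^sub>v (mat_adjoint B *\<^sub>v y) \<in> carrier_vec n" using H x by auto
  have BHx: "B *\<^sub>v (H *\<^sub>v (mat_adjoint B *\<^sub>v y)) \<in> carrier_vec m" using B Hx by auto
  have "Phi_plus t B H *\<^sub>v y = (complex_of_real t * mat_trace H) \<cdot>\<^sub>v y + (B * H * mat_adjoint B) *\<^sub>v y"
    unfolding Phi_plus_def using B H B' y
    by (subst add_mult_distrib_mat_vec[of _ m m]) (auto simp: smult_one_mult_vec)
  also have "(B * H * mat_adjoint B) *\<^sub>v y = B *\<^sub>v (H *\<^sub>v (mat_adjoint B *\<^sub>v y))"
    using B H B' y x by (simp add: assoc_mult_mat_vec[of _ m n _ m] assoc_mult_mat_vec[of _ m n _ n])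
  finally have "re_inner (Phi_plus t B H *\<^sub>v y) y =
      re_inner ((complex_of_real t * mat_trace H) \<cdot>\<^sub>v y) y + re_inner (B *\<^sub>v (H *\<^sub>v (mat_adjoint B *\<^sub>v y))) y"
    using BHx y by (simp add: re_inner_add_left[of _ m])
  also have "re_inner ((complex_of_real t * mat_trace H) \<cdot>\<^sub>v y) y = t * Re (mat_trace H) * re_inner y y"
    unfolding re_inner_def[of "_ \<cdot>\<^sub>v y"] using y by (simp add: cscalar_prod_self)
  finally show ?thesis using re_inner_adjoint[OF B Hx y] by simp
qed

text \<open>The lower bound for an arbitrary phase \<open>w\<close>, to be specialised to one that
  turns the trace of \<open>X\<close> into its modulus. As \<open>A + C\<close> enters shifted by
  \<open>\<beta>\<close> times its trace, it suffices to find a \<open>j\<close>-dimensional space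
  on which the form of \<open>A + C\<close>, pulled back by the adjoint of \<open>B\<close>, is at
  least \<open>\<mu> - q\<close> times the squared norm.\<close>

lemma sing_val_Phi_plus_ge:
  fixes A B C X :: "complex mat"
  assumes A: "A \<in> carrier_mat n n" and X: "X \<in> carrier_mat n n" and C: "C \<in> carrier_mat n n"
    and psd: "psd (four_block_mat A X (mat_adjoint X) C)"
    and B: "B \<in> carrier_mat m n" and n: "1 \<le> n" and j: "1 \<le> j" "j \<le> m"
    and w: "cmod w = 1" and \<beta>: "(sing_val 1 B)\<^sup>2 \<le> 2 * \<beta>"
  shows "2 * (sing_val j (B * X * mat_adjoint B) + \<beta> * Re (w * mat_trace X)) \<le>
    sing_val j (Phi_plus \<beta> B (A + C))"
proof -
  note B' = mat_adjoint_carrier[OF B] and X' = mat_adjoint_carrier[OF X]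
  note S = block_compression_carrier[OF A X C psd, of "- w"]
  have w': "cmod (- w) = 1" using w by simp
  note S_psd = psd_block_compression[OF A X C psd w']
  have AC: "A + C \<in> carrier_mat n n" using A C by simp
  let ?S = "block_compression (- w) A X C"
  let ?X = "B * X * mat_adjoint B"
  let ?P = "Phi_plus \<beta> B (A + C)"
  define \<mu> where "\<mu> = 2 * sing_val j ?X"
  define t where "t = Re (mat_trace (A + C))"
  define q where "q = \<beta> * Re (mat_trace ?S)"
  have BX: "?X \<in> carrier_mat m m" using B X B' by (simp add: mult_carrier_mat[of _ m n])
  have P: "?P \<in> carrier_mat m m"
    using B AC B' by (simp add: Phi_plus_def mult_carrier_mat[of _ m n])
  have \<beta>0: "0 \<le> \<beta>" using \<beta> by (smt (verit) zero_le_power2)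
  have q0: "0 \<le> q" using psd_trace_nonneg[OF S_psd S] \<beta>0 by (simp add: q_def)
  \<comment> \<open>The trace of \<open>A + C\<close> cancels and only the cross term
    survives.\<close>
  have q_eq: "\<beta> * t - q = 2 * \<beta> * Re (w * mat_trace X)"
    by (simp add: q_def t_def mat_trace_block_compression[OF A X C psd] algebra_simps)
  have x: "mat_adjoint B *\<^sub>v y \<in> carrier_vec n" for y using B by auto
  \<comment> \<open>The form of \<open>?S\<close> is at most its trace times the squared norm, the
    adjoint of \<open>B\<close> scales squared norms by at most sigma_1^2, and the hypothesis on
    \<open>\<beta>\<close> bounds this by \<open>2 * \<beta>\<close>.\<close>
  have trace: "re_inner (?S *\<^sub>v (mat_adjoint B *\<^sub>v y)) (mat_adjoint B *\<^sub>v y) \<le> 2 * q * re_inner y y"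
    if y: "y \<in> carrier_vec m" for y
  proof -
    have "re_inner (?S *\<^sub>v (mat_adjoint B *\<^sub>v y)) (mat_adjoint B *\<^sub>v y) \<le>
        Re (mat_trace ?S) * re_inner (mat_adjoint B *\<^sub>v y) (mat_adjoint B *\<^sub>v y)"
      by (rule psd_re_inner_le_trace[OF S_psd S x])
    also have "\<dots> \<le> Re (mat_trace ?S) * ((sing_val 1 B)\<^sup>2 * re_inner y y)"
      by (intro mult_left_mono re_inner_adjoint_mult_le_sing_val_1[OF B n y] psd_trace_nonneg[OF S_psd S])
    also have "\<dots> \<le> Re (mat_trace ?S) * ((2 * \<beta>) * re_inner y y)"
      by (intro mult_left_mono mult_right_mono \<beta> psd_trace_nonneg[OF S_psd S]) simp
    finally show ?thesis by (simp add: q_def mult_ac)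
  qed
  have "\<mu> - q + \<beta> * t \<le> sing_val j ?P"
  proof (cases "\<mu> \<le> q")
    case True
    \<comment> \<open>Only the bound \<open>\<beta> * t\<close> is needed here, and the form of
      \<open>A + C\<close> is nonnegative, so any \<open>j\<close>-dimensional space works; the
      columns of \<open>?Y\<close> are the first \<open>j\<close> coordinate vectors.\<close>
    let ?Y = "mat m j (\<lambda>(i, l). if i = l then 1 else 0) :: complex mat"
    have "\<beta> * t \<le> sing_val j ?P"
    proof (rule sing_val_ge_re_inner[OF P j, of ?Y])
      fix c :: "complex vec" assume c: "c \<in> carrier_vec j"
      have Y: "?Y *\<^sub>v c \<in> carrier_vec m" by (rule mult_mat_vec_carrier[OF _ c]) simp
      have "0 \<le> re_inner ((A + C) *\<^sub>v (mat_adjoint B *\<^sub>v y)) (mat_adjoint B *\<^sub>v y)" for y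
        using block_compression_sum[OF A X C psd x, of w y]
          psd_re_inner[OF S_psd S x, of y]
          psd_re_inner[OF psd_block_compression[OF A X C psd w] block_compression_carrier[OF A X C psd] x, of y]
        by linarith
      then show "\<beta> * t * re_inner (?Y *\<^sub>v c) (?Y *\<^sub>v c) \<le> re_inner (?P *\<^sub>v (?Y *\<^sub>v c)) (?Y *\<^sub>v c)"
        by (simp add: re_inner_Phi_plus[OF B AC Y] t_def)
      assume "c \<noteq> 0\<^sub>v j"
      moreover have "c = 0\<^sub>v j" if "\<forall>i<j. c $ i = 0"
        using that c by (intro eq_vecI) auto
      ultimately obtain i where i: "i < j" "c $ i \<noteq> 0" by blast
      have "(?Y *\<^sub>v c) $ i = (\<Sum>l<j. (if i = l then 1 else 0) * c $ l)"
        using i c j by (simp add: scalar_prod_def atLeast0LessThan)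
      also have "\<dots> = (\<Sum>l<j. if i = l then c $ l else 0)"
        by (intro sum.cong) auto
      finally have "(?Y *\<^sub>v c) $ i \<noteq> 0" using i by simp
      then show "?Y *\<^sub>v c \<noteq> 0\<^sub>v m"
        using i j by (metis index_zero_vec(1) order_less_le_trans)
    qed simp
    then show ?thesis using True by simp
  next
    case False
    then have mu: "q < \<mu>" by simp
    then have "0 < sing_val j ?X" using q0 by (simp add: \<mu>_def)
    then obtain Y Z where Y: "Y \<in> carrier_mat m j" and Z: "Z \<in> carrier_mat m j"
      and Yc: "\<And>c. c \<in> carrier_vec j \<Longrightarrow> re_inner (Y *\<^sub>v c) (Y *\<^sub>v c) = re_inner c c"
      and Zc: "\<And>c. c \<in> carrier_vec j \<Longrightarrow> re_inner (Z *\<^sub>v c) (Z *\<^sub>v c) = re_inner c c"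
      and ge: "\<And>c. c \<in> carrier_vec j \<Longrightarrow> sing_val j ?X * re_inner c c \<le> re_inner (?X *\<^sub>v (Y *\<^sub>v c)) (Z *\<^sub>v c)"
      by (rule sing_val_frame[OF BX j]) (rule that)
    let ?Z = "mat_adjoint B * Z" and ?Y = "mat_adjoint B * Y"
    have ZY: "?Z \<in> carrier_mat n j" "?Y \<in> carrier_mat n j" using B' Z Y by auto
    \<comment> \<open>\<open>N c\<close> is the vector \<open>y\<close> of the estimate for
      \<open>u = Z c\<close> and \<open>v = Y c\<close>. It is linear in \<open>c\<close>, and
      positivity of its norm for nonzero \<open>c\<close> makes \<open>N\<close> injective, so these
      vectors fill a space of dimension \<open>j\<close>.\<close>
    define N where "N = B * (A * ?Z + X * ?Y) + cnj w \<cdot>\<^sub>m (B * (mat_adjoint X * ?Z + C * ?Y))"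
    have N: "N \<in> carrier_mat m j"
      using A B C X X' ZY by (simp add: N_def mult_carrier_mat[of _ m n] mult_carrier_mat[of _ n n])
    have sum_mult: "(B * (R * ?Z + Q * ?Y)) *\<^sub>v c =
        B *\<^sub>v (R *\<^sub>v (mat_adjoint B *\<^sub>v (Z *\<^sub>v c)) + Q *\<^sub>v (mat_adjoint B *\<^sub>v (Y *\<^sub>v c)))"
      if R: "R \<in> carrier_mat n n" and Q: "Q \<in> carrier_mat n n" and c: "c \<in> carrier_vec j" for R Q c
    proof -
      have RQ: "R * ?Z \<in> carrier_mat n j" "Q * ?Y \<in> carrier_mat n j"
        using mult_carrier_mat[OF R ZY(1)] mult_carrier_mat[OF Q ZY(2)] by auto
      have "(B * (R * ?Z + Q * ?Y)) *\<^sub>v c = B *\<^sub>v ((R * ?Z) *\<^sub>v c + (Q * ?Y) *\<^sub>v c)"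
        using assoc_mult_mat_vec[OF B _ c, of "R * ?Z + Q * ?Y"] add_mult_distrib_mat_vec[OF RQ c] RQ by simp
      then show ?thesis
        by (simp only: assoc_mult_mat_vec[OF R ZY(1) c] assoc_mult_mat_vec[OF Q ZY(2) c]
            assoc_mult_mat_vec[OF B' Z c] assoc_mult_mat_vec[OF B' Y c])
    qed
    have Nc: "N *\<^sub>v c =
        B *\<^sub>v (A *\<^sub>v (mat_adjoint B *\<^sub>v (Z *\<^sub>v c)) + X *\<^sub>v (mat_adjoint B *\<^sub>v (Y *\<^sub>v c))) +
        cnj w \<cdot>\<^sub>v (B *\<^sub>v (mat_adjoint X *\<^sub>v (mat_adjoint B *\<^sub>v (Z *\<^sub>v c)) + C *\<^sub>v (mat_adjoint B *\<^sub>v (Y *\<^sub>v c))))"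
      if c: "c \<in> carrier_vec j" for c
    proof -
      have 1: "B * (A * ?Z + X * ?Y) \<in> carrier_mat m j"
        using B A X ZY by (simp add: mult_carrier_mat[of _ m n] mult_carrier_mat[of _ n n])
      have 2: "B * (mat_adjoint X * ?Z + C * ?Y) \<in> carrier_mat m j"
        using B X' C ZY by (simp add: mult_carrier_mat[of _ m n] mult_carrier_mat[of _ n n])
      have "N *\<^sub>v c = (B * (A * ?Z + X * ?Y)) *\<^sub>v c + cnj w \<cdot>\<^sub>v ((B * (mat_adjoint X * ?Z + C * ?Y)) *\<^sub>v c)"
        unfolding N_def
        by (simp only: add_mult_distrib_mat_vec[OF 1 smult_carrier_mat[OF 2] c] smult_mat_mult_vec[OF 2 c])
      then show ?thesis by (simp only: sum_mult[OF A X c] sum_mult[OF X' C c])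
    qed
    have estimate: "0 < re_inner (N *\<^sub>v c) (N *\<^sub>v c)" "(\<mu> - q) * re_inner (N *\<^sub>v c) (N *\<^sub>v c) \<le>
        re_inner ((A + C) *\<^sub>v (mat_adjoint B *\<^sub>v (N *\<^sub>v c))) (mat_adjoint B *\<^sub>v (N *\<^sub>v c))"
      if c: "c \<in> carrier_vec j" "c \<noteq> 0\<^sub>v j" for c
    proof -
      have u: "Z *\<^sub>v c \<in> carrier_vec m" and v: "Y *\<^sub>v c \<in> carrier_vec m"
        using Z Y c by (auto intro: mult_mat_vec_carrier)
      have eq: "re_inner (Z *\<^sub>v c) (Z *\<^sub>v c) = re_inner (Y *\<^sub>v c) (Y *\<^sub>v c)"
        and pos: "0 < re_inner (Y *\<^sub>v c) (Y *\<^sub>v c)"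
        using Yc[OF c(1)] Zc[OF c(1)] re_inner_pos[OF c] by auto
      have sigma: "\<mu> * re_inner (Y *\<^sub>v c) (Y *\<^sub>v c) \<le> 2 * re_inner (?X *\<^sub>v (Y *\<^sub>v c)) (Z *\<^sub>v c)"
        using ge[OF c(1)] Yc[OF c(1)] by (simp add: \<mu>_def)
      note est = block_compression_estimate[OF A X C psd B w u v q0 mu trace eq pos sigma]
      show "0 < re_inner (N *\<^sub>v c) (N *\<^sub>v c)"
        unfolding Nc[OF c(1)] by (rule est(1))
      show "(\<mu> - q) * re_inner (N *\<^sub>v c) (N *\<^sub>v c) \<le>
          re_inner ((A + C) *\<^sub>v (mat_adjoint B *\<^sub>v (N *\<^sub>v c))) (mat_adjoint B *\<^sub>v (N *\<^sub>v c))"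
        unfolding Nc[OF c(1)] by (rule est(2))
    qed
    show ?thesis
    proof (rule sing_val_ge_re_inner[OF P j N])
      fix c :: "complex vec" assume c: "c \<in> carrier_vec j"
      have y: "N *\<^sub>v c \<in> carrier_vec m" by (rule mult_mat_vec_carrier[OF N c])
      show "(\<mu> - q + \<beta> * t) * re_inner (N *\<^sub>v c) (N *\<^sub>v c) \<le> re_inner (?P *\<^sub>v (N *\<^sub>v c)) (N *\<^sub>v c)"
      \<comment> \<open>The estimate requires a nonzero vector, so \<open>c = 0\<close> is treated
        apart.\<close>
      proof (cases "c = 0\<^sub>v j")
        case True
        then have "N *\<^sub>v c = 0\<^sub>v m" using N by auto
        then show ?thesis using P by (simp add: re_inner_def)
      next
        case False
        then show ?thesis
          using estimate(2)[OF c False] by (simp add: re_inner_Phi_plus[OF B AC y] t_def algebra_simps)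
      qed
      show "N *\<^sub>v c \<noteq> 0\<^sub>v m" if "c \<noteq> 0\<^sub>v j"
        using estimate(1)[OF c that] by (auto simp: re_inner_def)
    qed
  qed
  then show ?thesis using q_eq by (simp add: \<mu>_def algebra_simps)
qed

theorem theorem5p2:
  fixes m n j :: nat and \<alpha> :: real and A B C X :: "complex mat"
  assumes "m \<ge> 1" and "n \<ge> 1"
    and "B \<in> carrier_mat m n"
    and "A \<in> carrier_mat n n" and "X \<in> carrier_mat n n" and "C \<in> carrier_mat n n"
    and "psd (four_block_mat A X (mat_adjoint X) C)"
    and "\<bar>\<alpha>\<bar> \<ge> 1 / 2 * (sing_val 1 B)\<^sup>2"
    and "j \<in> {1..m}"
  shows "2 * sing_val j (Phi_plus \<alpha> B X)
           \<le> 2 * (sing_val j (B * X * mat_adjoint B) + \<bar>\<alpha>\<bar> * cmod (mat_trace X))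
       \<and> 2 * (sing_val j (B * X * mat_adjoint B) + \<bar>\<alpha>\<bar> * cmod (mat_trace X))
           \<le> sing_val j (Phi_plus \<bar>\<alpha>\<bar> B (A + C))"
proof
  have j: "1 \<le> j" "j \<le> m" using assms(9) by auto
  have BX: "B * X * mat_adjoint B \<in> carrier_mat m m"
    using assms(3,5) mat_adjoint_carrier[OF assms(3)] by (simp add: mult_carrier_mat[of _ m n])
  \<comment> \<open>\<open>Phi_plus \<alpha> B X\<close> is a scalar shift of
    \<open>B * X * mat_adjoint B\<close>, and the modulus of the scalar is the second
    summand.\<close>
  show "2 * sing_val j (Phi_plus \<alpha> B X)
      \<le> 2 * (sing_val j (B * X * mat_adjoint B) + \<bar>\<alpha>\<bar> * cmod (mat_trace X))"
    using sing_val_add_scalar_le[OF BX j, of "complex_of_real \<alpha> * mat_trace X"] assms(3)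
    by (simp add: Phi_plus_def norm_mult)
  \<comment> \<open>The conjugate phase of the trace; if the trace vanishes any unit number serves,
    and 1 is taken.\<close>
  define w where "w = (if mat_trace X = 0 then 1 else cnj (mat_trace X) / complex_of_real (cmod (mat_trace X)))"
  have w: "cmod w = 1" by (simp add: w_def norm_divide)
  have "Re (w * mat_trace X) = cmod (mat_trace X)"
  proof (cases "mat_trace X = 0")
    case False
    then have "w * mat_trace X = (mat_trace X * cnj (mat_trace X)) / complex_of_real (cmod (mat_trace X))"
      by (simp add: w_def)
    then have "Re (w * mat_trace X) = (cmod (mat_trace X))\<^sup>2 / cmod (mat_trace X)"
      by (simp only: Re_divide_of_real Re_mult_cnj_self)
    then show ?thesis by (simp add: power2_eq_square)
  qed simp
  then show "2 * (sing_val j (B * X * mat_adjoint B) + \<bar>\<alpha>\<bar> * cmod (mat_trace X))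
      \<le> sing_val j (Phi_plus \<bar>\<alpha>\<bar> B (A + C))"
    using sing_val_Phi_plus_ge[OF assms(4,5,6,7,3,2) j w, of "\<bar>\<alpha>\<bar>"] assms(8) by simp
qed

end
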